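(* Let $(\mathcal{A},\Sigma)$ be a PIE indexing pair and let $F:\mathcal{A}\to\mathcal{B}$ be a 2-functor. Then the $\sigma$-s-limit of $F$ (with respect to $\Sigma$) can be constructed from products, inserters, and equifiers.
   Context: **Indexing pairs.** An indexing pair $(\mathcal{A},\Sigma)$ is a (small) 2-category $\mathcal{A}$ with a family $\Sigma$ of its arrows, closed under composition and containing all identities. It is PIE if, in the 1-subcategory of $\mathcal{A}$ given by all objects of $\mathcal{A}$ and the arrows of $\Sigma$, each connected component has an initial object. **$\sigma$-s-limits.** Let $F:\mathcal{A}\to\mathcal{B}$ be a 2-functor and $E\in\mathcal{B}$. A lax cone for $F$ with vertex $E$ consists of arrows $\theta_A:E\to FA$ ($A\in\mathcal{A}$) and 2-cells $\theta_f:Ff\,\theta_A\Rightarrow\theta_B$ (for $f:A\to B$) such that $\theta_{id_A}=id_{\theta_A}$; $\theta_{gf}=\theta_g\circ Fg\,\theta_f$ for $A\xrightarrow{f}B\xrightarrow{g}C$; and $\theta_f=\theta_g\circ F\gamma\,\theta_A$ for each 2-cell $\gamma:f\Rightarrow g:A\to B$. A morphism $\alpha:\theta\to\theta'$ is a family of 2-cells $\alpha_A:\theta_A\Rightarrow\theta'_A$ with $\theta'_f\circ Ff\,\alpha_A=\alpha_B\circ\theta_f$ for all $f:A\to B$. A $\sigma$-s-cone is a lax cone with $\theta_f$ an identity 2-cell for every $f\in\Sigma$ (full subcategory). The $\sigma$-s-limit of $F$ with respect to $\Sigma$ is a universal $\sigma$-s-cone $\pi$ with vertex $L$: for each $E\in\mathcal{B}$,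 composition with $\pi$ is an isomorphism of categories from $\mathcal{B}(E,L)$ to the category of $\sigma$-s-cones with vertex $E$. **Products, inserters, equifiers.** All limits are 2-limits (universal properties are isomorphisms of hom-categories). The inserter of $f,g:A\to B$ is the universal $p:I\to A$ together with a 2-cell $\lambda:fp\Rightarrow gp$; the equifier of a pair of parallel 2-cells $\alpha,\beta:f\Rightarrow g:A\to B$ is the universal $p:I\to A$ with $\alpha p=\beta p$. That a limit "can be constructed from products, inserters, and equifiers" means that, in a 2-category $\mathcal{B}$ having products, inserters and equifiers, the limit (with its limit cone) exists and is obtained from the diagram by iteratively taking products, inserters and equifiers. *)

theory Defs
  imports Main "HOL-Library.FuncSet" "HOL-Library.Equipollence"
begin

section \<open>Categories and functors\<close>

text \<open>Composition is written in the order of function composition.\<close>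

record ('o, 'm) cat =
  Ob :: "'o set"
  Mor :: "'m set"
  Dom :: "'m \<Rightarrow> 'o"
  Cod :: "'m \<Rightarrow> 'o"
  Ide :: "'o \<Rightarrow> 'm"
  Comp :: "'m \<Rightarrow> 'm \<Rightarrow> 'm" (infixl "\<cdot>\<index>" 70)

locale category =
  fixes C :: "('o, 'm, 'z) cat_scheme" (structure)
  assumes Dom_Ob: "f \<in> Mor C \<Longrightarrow> Dom C f \<in> Ob C"
    and Cod_Ob: "f \<in> Mor C \<Longrightarrow> Cod C f \<in> Ob C"
    and Ide_Mor: "X \<in> Ob C \<Longrightarrow> Ide C X \<in> Mor C"
    and Dom_Ide: "X \<in> Ob C \<Longrightarrow> Dom C (Ide C X) = X"
    and Cod_Ide: "X \<in> Ob C \<Longrightarrow> Cod C (Ide C X) = X"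
    and Comp_Mor: "\<lbrakk>f \<in> Mor C; g \<in> Mor C; Dom C g = Cod C f\<rbrakk> \<Longrightarrow> g \<cdot> f \<in> Mor C"
    and Dom_Comp: "\<lbrakk>f \<in> Mor C; g \<in> Mor C; Dom C g = Cod C f\<rbrakk> \<Longrightarrow> Dom C (g \<cdot> f) = Dom C f"
    and Cod_Comp: "\<lbrakk>f \<in> Mor C; g \<in> Mor C; Dom C g = Cod C f\<rbrakk> \<Longrightarrow> Cod C (g \<cdot> f) = Cod C g"
    and Comp_Ide: "f \<in> Mor C \<Longrightarrow> f \<cdot> Ide C (Dom C f) = f"
    and Ide_Comp: "f \<in> Mor C \<Longrightarrow> Ide C (Cod C f) \<cdot> f = f"
    and Comp_assoc: "\<lbrakk>f \<in> Mor C; g \<in> Mor C; h \<in> Mor C; Dom C g = Cod C f; Dom C h = Cod C g\<rbrakk>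
      \<Longrightarrow> (h \<cdot> g) \<cdot> f = h \<cdot> (g \<cdot> f)"

definition is_functor ::
  "('o, 'm, 'y) cat_scheme \<Rightarrow> ('p, 'n, 'z) cat_scheme \<Rightarrow> ('o \<Rightarrow> 'p) \<Rightarrow> ('m \<Rightarrow> 'n) \<Rightarrow> bool" where
  "is_functor C D Fo Fm \<longleftrightarrow>
    (\<forall>X\<in>Ob C. Fo X \<in> Ob D) \<and>
    (\<forall>f\<in>Mor C. Fm f \<in> Mor D \<and> Dom D (Fm f) = Fo (Dom C f) \<and> Cod D (Fm f) = Fo (Cod C f)) \<and>
    (\<forall>X\<in>Ob C. Fm (Ide C X) = Ide D (Fo X)) \<and>
    (\<forall>f\<in>Mor C. \<forall>g\<in>Mor C. Dom C g = Cod C f \<longrightarrow> Fm (g \<cdot>\<^bsub>C\<^esub> f) = Fm g \<cdot>\<^bsub>D\<^esub> Fm f)"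

definition iso_functor ::
  "('o, 'm, 'y) cat_scheme \<Rightarrow> ('p, 'n, 'z) cat_scheme \<Rightarrow> ('o \<Rightarrow> 'p) \<Rightarrow> ('m \<Rightarrow> 'n) \<Rightarrow> bool" where
  "iso_functor C D Fo Fm \<longleftrightarrow> is_functor C D Fo Fm \<and>
    (\<exists>Go Gm. is_functor D C Go Gm \<and>
      (\<forall>X\<in>Ob C. Go (Fo X) = X) \<and> (\<forall>f\<in>Mor C. Gm (Fm f) = f) \<and>
      (\<forall>Y\<in>Ob D. Fo (Go Y) = Y) \<and> (\<forall>g\<in>Mor D. Fm (Gm g) = g))"

definition full_subcat :: "('o, 'm) cat \<Rightarrow> 'o set \<Rightarrow> ('o, 'm) cat" where
  "full_subcat C S = C\<lparr>Ob := Ob C \<inter> S, Mor := {f \<in> Mor C. Dom C f \<in> S \<and> Cod C f \<in> S}\<rparr>"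

definition prod_cat :: "'i set \<Rightarrow> ('i \<Rightarrow> ('o, 'm) cat) \<Rightarrow> ('i \<Rightarrow> 'o, 'i \<Rightarrow> 'm) cat" where
  "prod_cat I C = \<lparr>Ob = (\<Pi>\<^sub>E i\<in>I. Ob (C i)), Mor = (\<Pi>\<^sub>E i\<in>I. Mor (C i)),
    Dom = (\<lambda>f. \<lambda>i\<in>I. Dom (C i) (f i)), Cod = (\<lambda>f. \<lambda>i\<in>I. Cod (C i) (f i)),
    Ide = (\<lambda>X. \<lambda>i\<in>I. Ide (C i) (X i)), Comp = (\<lambda>g f. \<lambda>i\<in>I. g i \<cdot>\<^bsub>C i\<^esub> f i)\<rparr>"

definition connected_component :: "('o, 'm) cat \<Rightarrow> 'o \<Rightarrow> 'o set" where
  "connected_component C X =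
    (let R = {(Y, Z). \<exists>f\<in>Mor C. Dom C f = Y \<and> Cod C f = Z}
     in {Y \<in> Ob C. (X, Y) \<in> (R \<union> R\<inverse>)\<^sup>*})"

definition initial_object :: "('o, 'm) cat \<Rightarrow> 'o \<Rightarrow> bool" where
  "initial_object C X \<longleftrightarrow> X \<in> Ob C \<and>
    (\<forall>Y\<in>Ob C. \<exists>!f. f \<in> Mor C \<and> Dom C f = X \<and> Cod C f = Y)"


section \<open>Strict 2-categories and 2-functors\<close>

text \<open>The inherited fields are the objects and arrows; \<open>Comp2\<close> is vertical and \<open>HComp\<close>
  horizontal composition of 2-cells.\<close>

record ('o, 'a, 'c) twocat = "('o, 'a) cat" +
  Cell :: "'c set"
  Dom2 :: "'c \<Rightarrow> 'a"
  Cod2 :: "'c \<Rightarrow> 'a"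
  Ide2 :: "'a \<Rightarrow> 'c"
  Comp2 :: "'c \<Rightarrow> 'c \<Rightarrow> 'c" (infixl "\<bullet>\<index>" 70)
  HComp :: "'c \<Rightarrow> 'c \<Rightarrow> 'c" (infixl "\<star>\<index>" 72)

text \<open>The disjoint union of all hom-categories.\<close>

definition vert_cat :: "('o, 'a, 'c) twocat \<Rightarrow> ('a, 'c) cat" where
  "vert_cat B = \<lparr>Ob = Mor B, Mor = Cell B, Dom = Dom2 B, Cod = Cod2 B,
    Ide = Ide2 B, Comp = Comp2 B\<rparr>"

definition hom_cat :: "('o, 'a, 'c) twocat \<Rightarrow> 'o \<Rightarrow> 'o \<Rightarrow> ('a, 'c) cat" where
  "hom_cat B X Y = full_subcat (vert_cat B) {f. Dom B f = X \<and> Cod B f = Y}"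

locale two_category = category B + vert: category "vert_cat B"
  for B :: "('o, 'a, 'c) twocat" (structure) +
  assumes Dom_Cod2: "\<alpha> \<in> Cell B \<Longrightarrow> Dom B (Cod2 B \<alpha>) = Dom B (Dom2 B \<alpha>)"
    and Cod_Cod2: "\<alpha> \<in> Cell B \<Longrightarrow> Cod B (Cod2 B \<alpha>) = Cod B (Dom2 B \<alpha>)"
    and HComp_Cell: "\<lbrakk>\<alpha> \<in> Cell B; \<beta> \<in> Cell B; Dom B (Dom2 B \<beta>) = Cod B (Dom2 B \<alpha>)\<rbrakk>
      \<Longrightarrow> \<beta> \<star> \<alpha> \<in> Cell B"
    and Dom2_HComp: "\<lbrakk>\<alpha> \<in> Cell B; \<beta> \<in> Cell B; Dom B (Dom2 B \<beta>) = Cod B (Dom2 B \<alpha>)\<rbrakk>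
      \<Longrightarrow> Dom2 B (\<beta> \<star> \<alpha>) = Dom2 B \<beta> \<cdot> Dom2 B \<alpha>"
    and Cod2_HComp: "\<lbrakk>\<alpha> \<in> Cell B; \<beta> \<in> Cell B; Dom B (Dom2 B \<beta>) = Cod B (Dom2 B \<alpha>)\<rbrakk>
      \<Longrightarrow> Cod2 B (\<beta> \<star> \<alpha>) = Cod2 B \<beta> \<cdot> Cod2 B \<alpha>"
    and HComp_assoc: "\<lbrakk>\<alpha> \<in> Cell B; \<beta> \<in> Cell B; \<gamma> \<in> Cell B;
        Dom B (Dom2 B \<beta>) = Cod B (Dom2 B \<alpha>); Dom B (Dom2 B \<gamma>) = Cod B (Dom2 B \<beta>)\<rbrakk>
      \<Longrightarrow> (\<gamma> \<star> \<beta>) \<star> \<alpha> = \<gamma> \<star> (\<beta> \<star> \<alpha>)"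
    and HComp_Ide: "\<alpha> \<in> Cell B \<Longrightarrow> \<alpha> \<star> Ide2 B (Ide B (Dom B (Dom2 B \<alpha>))) = \<alpha>"
    and Ide_HComp: "\<alpha> \<in> Cell B \<Longrightarrow> Ide2 B (Ide B (Cod B (Dom2 B \<alpha>))) \<star> \<alpha> = \<alpha>"
    and HComp_Ide2: "\<lbrakk>f \<in> Mor B; g \<in> Mor B; Dom B g = Cod B f\<rbrakk>
      \<Longrightarrow> Ide2 B g \<star> Ide2 B f = Ide2 B (g \<cdot> f)"
    and interchange: "\<lbrakk>\<alpha> \<in> Cell B; \<alpha>' \<in> Cell B; \<beta> \<in> Cell B; \<beta>' \<in> Cell B;
        Dom2 B \<alpha>' = Cod2 B \<alpha>; Dom2 B \<beta>' = Cod2 B \<beta>; Dom B (Dom2 B \<beta>) = Cod B (Dom2 B \<alpha>)\<rbrakk>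
      \<Longrightarrow> (\<beta>' \<bullet> \<beta>) \<star> (\<alpha>' \<bullet> \<alpha>) = (\<beta>' \<star> \<alpha>') \<bullet> (\<beta> \<star> \<alpha>)"

definition lwhisk :: "('o, 'a, 'c) twocat \<Rightarrow> 'a \<Rightarrow> 'c \<Rightarrow> 'c" where
  "lwhisk B f \<alpha> = Ide2 B f \<star>\<^bsub>B\<^esub> \<alpha>"

definition rwhisk :: "('o, 'a, 'c) twocat \<Rightarrow> 'c \<Rightarrow> 'a \<Rightarrow> 'c" where
  "rwhisk B \<alpha> f = \<alpha> \<star>\<^bsub>B\<^esub> Ide2 B f"

record ('oa, 'aa, 'ca, 'ob, 'ab, 'cb) twofun =
  Fun0 :: "'oa \<Rightarrow> 'ob"
  Fun1 :: "'aa \<Rightarrow> 'ab"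
  Fun2 :: "'ca \<Rightarrow> 'cb"

definition two_functor :: "('oa, 'aa, 'ca) twocat \<Rightarrow> ('ob, 'ab, 'cb) twocat
    \<Rightarrow> ('oa, 'aa, 'ca, 'ob, 'ab, 'cb) twofun \<Rightarrow> bool" where
  "two_functor A B F \<longleftrightarrow>
    is_functor A B (Fun0 F) (Fun1 F) \<and>
    is_functor (vert_cat A) (vert_cat B) (Fun1 F) (Fun2 F) \<and>
    (\<forall>\<alpha>\<in>Cell A. \<forall>\<beta>\<in>Cell A. Dom A (Dom2 A \<beta>) = Cod A (Dom2 A \<alpha>)
      \<longrightarrow> Fun2 F (\<beta> \<star>\<^bsub>A\<^esub> \<alpha>) = Fun2 F \<beta> \<star>\<^bsub>B\<^esub> Fun2 F \<alpha>)"


section \<open>Indexing pairs\<close>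

text \<open>Size convention: a set is small if it embeds into a fixed set \<open>U\<close>. Below, products are
  indexed by subsets of \<open>U\<close>. No closure property of \<open>U\<close> is assumed.\<close>

definition small_two_category :: "'i set \<Rightarrow> ('o, 'a, 'c) twocat \<Rightarrow> bool" where
  "small_two_category U A \<longleftrightarrow>
    two_category A \<and> Ob A \<lesssim> U \<and> Mor A \<lesssim> U \<and> Cell A \<lesssim> U"

definition indexing_pair :: "'i set \<Rightarrow> ('o, 'a, 'c) twocat \<Rightarrow> 'a set \<Rightarrow> bool" where
  "indexing_pair U A S \<longleftrightarrow> small_two_category U A \<and> S \<subseteq> Mor A \<and>
    (\<forall>X\<in>Ob A. Ide A X \<in> S) \<and>
    (\<forall>f\<in>S. \<forall>g\<in>S. Dom A g = Cod A f \<longrightarrow> g \<cdot>\<^bsub>A\<^esub> f \<in> S)"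

definition wide_subcat :: "('o, 'a, 'c) twocat \<Rightarrow> 'a set \<Rightarrow> ('o, 'a) cat" where
  "wide_subcat A S = \<lparr>Ob = Ob A, Mor = S, Dom = Dom A, Cod = Cod A, Ide = Ide A, Comp = Comp A\<rparr>"

definition PIE_indexing_pair :: "'i set \<Rightarrow> ('o, 'a, 'c) twocat \<Rightarrow> 'a set \<Rightarrow> bool" where
  "PIE_indexing_pair U A S \<longleftrightarrow> indexing_pair U A S \<and>
    (\<forall>X\<in>Ob A. \<exists>Z. initial_object
      (full_subcat (wide_subcat A S) (connected_component (wide_subcat A S) X)) Z)"


section \<open>\<open>\<sigma>\<close>-s-cones and \<open>\<sigma>\<close>-s-limits\<close>

text \<open>Families indexed by objects or arrows are extensional functions, so that equality of
  cones is equality of families. Morphisms of cones carry their domain and codomain.\<close>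

record ('oa, 'aa, 'ab, 'cb) cone =
  leg :: "'oa \<Rightarrow> 'ab"
  tri :: "'aa \<Rightarrow> 'cb"

definition lax_cone :: "('oa, 'aa, 'ca) twocat \<Rightarrow> ('ob, 'ab, 'cb) twocat
    \<Rightarrow> ('oa, 'aa, 'ca, 'ob, 'ab, 'cb) twofun \<Rightarrow> 'ob \<Rightarrow> ('oa, 'aa, 'ab, 'cb) cone \<Rightarrow> bool" where
  "lax_cone A B F E \<theta> \<longleftrightarrow>
    leg \<theta> \<in> (\<Pi>\<^sub>E X\<in>Ob A. {h \<in> Mor B. Dom B h = E \<and> Cod B h = Fun0 F X}) \<and>
    tri \<theta> \<in> (\<Pi>\<^sub>E f\<in>Mor A. {\<mu> \<in> Cell B. Dom2 B \<mu> = Fun1 F f \<cdot>\<^bsub>B\<^esub> leg \<theta> (Dom A f) \<and>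
      Cod2 B \<mu> = leg \<theta> (Cod A f)}) \<and>
    (\<forall>X\<in>Ob A. tri \<theta> (Ide A X) = Ide2 B (leg \<theta> X)) \<and>
    (\<forall>f\<in>Mor A. \<forall>g\<in>Mor A. Dom A g = Cod A f \<longrightarrow>
      tri \<theta> (g \<cdot>\<^bsub>A\<^esub> f) = tri \<theta> g \<bullet>\<^bsub>B\<^esub> lwhisk B (Fun1 F g) (tri \<theta> f)) \<and>
    (\<forall>\<gamma>\<in>Cell A. tri \<theta> (Dom2 A \<gamma>) =
      tri \<theta> (Cod2 A \<gamma>) \<bullet>\<^bsub>B\<^esub> rwhisk B (Fun2 F \<gamma>) (leg \<theta> (Dom A (Dom2 A \<gamma>))))"

type_synonym ('oa, 'aa, 'ab, 'cb) cone_mor =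
  "('oa, 'aa, 'ab, 'cb) cone \<times> ('oa \<Rightarrow> 'cb) \<times> ('oa, 'aa, 'ab, 'cb) cone"

definition lax_cone_cat :: "('oa, 'aa, 'ca) twocat \<Rightarrow> ('ob, 'ab, 'cb) twocat
    \<Rightarrow> ('oa, 'aa, 'ca, 'ob, 'ab, 'cb) twofun \<Rightarrow> 'ob
    \<Rightarrow> (('oa, 'aa, 'ab, 'cb) cone, ('oa, 'aa, 'ab, 'cb) cone_mor) cat" where
  "lax_cone_cat A B F E = \<lparr>
    Ob = {\<theta>. lax_cone A B F E \<theta>},
    Mor = {(\<theta>, \<alpha>, \<theta>'). lax_cone A B F E \<theta> \<and> lax_cone A B F E \<theta>' \<and>
      \<alpha> \<in> (\<Pi>\<^sub>E X\<in>Ob A. {\<mu> \<in> Cell B. Dom2 B \<mu> = leg \<theta> X \<and> Cod2 B \<mu> = leg \<theta>' X}) \<and>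
      (\<forall>f\<in>Mor A. tri \<theta>' f \<bullet>\<^bsub>B\<^esub> lwhisk B (Fun1 F f) (\<alpha> (Dom A f)) = \<alpha> (Cod A f) \<bullet>\<^bsub>B\<^esub> tri \<theta> f)},
    Dom = (\<lambda>(\<theta>, \<alpha>, \<theta>'). \<theta>),
    Cod = (\<lambda>(\<theta>, \<alpha>, \<theta>'). \<theta>'),
    Ide = (\<lambda>\<theta>. (\<theta>, \<lambda>X\<in>Ob A. Ide2 B (leg \<theta> X), \<theta>)),
    Comp = (\<lambda>(\<theta>', \<beta>, \<theta>'') (\<theta>, \<alpha>, \<theta>\<^sub>1). (\<theta>, \<lambda>X\<in>Ob A. \<beta> X \<bullet>\<^bsub>B\<^esub> \<alpha> X, \<theta>''))\<rparr>"

definition sigma_s_cone_cat :: "('oa, 'aa, 'ca) twocat \<Rightarrow> 'aa set \<Rightarrow> ('ob, 'ab, 'cb) twocat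
    \<Rightarrow> ('oa, 'aa, 'ca, 'ob, 'ab, 'cb) twofun \<Rightarrow> 'ob
    \<Rightarrow> (('oa, 'aa, 'ab, 'cb) cone, ('oa, 'aa, 'ab, 'cb) cone_mor) cat" where
  "sigma_s_cone_cat A S B F E =
    full_subcat (lax_cone_cat A B F E) {\<theta>. \<forall>f\<in>S. tri \<theta> f \<in> Ide2 B ` Mor B}"

definition cone_precomp :: "('oa, 'aa, 'ca) twocat \<Rightarrow> ('ob, 'ab, 'cb) twocat
    \<Rightarrow> ('oa, 'aa, 'ab, 'cb) cone \<Rightarrow> 'ab \<Rightarrow> ('oa, 'aa, 'ab, 'cb) cone" where
  "cone_precomp A B \<pi> h = \<lparr>leg = (\<lambda>X\<in>Ob A. leg \<pi> X \<cdot>\<^bsub>B\<^esub> h), tri = (\<lambda>f\<in>Mor A. rwhisk B (tri \<pi> f) h)\<rparr>"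

definition cone_precomp2 :: "('oa, 'aa, 'ca) twocat \<Rightarrow> ('ob, 'ab, 'cb) twocat
    \<Rightarrow> ('oa, 'aa, 'ab, 'cb) cone \<Rightarrow> 'cb \<Rightarrow> ('oa, 'aa, 'ab, 'cb) cone_mor" where
  "cone_precomp2 A B \<pi> \<alpha> =
    (cone_precomp A B \<pi> (Dom2 B \<alpha>), \<lambda>X\<in>Ob A. lwhisk B (leg \<pi> X) \<alpha>, cone_precomp A B \<pi> (Cod2 B \<alpha>))"

definition is_sigma_s_limit :: "('oa, 'aa, 'ca) twocat \<Rightarrow> 'aa set \<Rightarrow> ('ob, 'ab, 'cb) twocat
    \<Rightarrow> ('oa, 'aa, 'ca, 'ob, 'ab, 'cb) twofun \<Rightarrow> 'ob \<Rightarrow> ('oa, 'aa, 'ab, 'cb) cone \<Rightarrow> bool" where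
  "is_sigma_s_limit A S B F L \<pi> \<longleftrightarrow>
    L \<in> Ob B \<and> \<pi> \<in> Ob (sigma_s_cone_cat A S B F L) \<and>
    (\<forall>E\<in>Ob B. iso_functor (hom_cat B E L) (sigma_s_cone_cat A S B F E)
      (cone_precomp A B \<pi>) (cone_precomp2 A B \<pi>))"


section \<open>Products, inserters and equifiers\<close>

definition is_product :: "('o, 'a, 'c) twocat \<Rightarrow> 'i set \<Rightarrow> ('i \<Rightarrow> 'o) \<Rightarrow> 'o \<Rightarrow> ('i \<Rightarrow> 'a) \<Rightarrow> bool" where
  "is_product B I X P p \<longleftrightarrow>
    P \<in> Ob B \<and> (\<forall>i\<in>I. p i \<in> Mor B \<and> Dom B (p i) = P \<and> Cod B (p i) = X i) \<and>
    (\<forall>E\<in>Ob B. iso_functor (hom_cat B E P) (prod_cat I (\<lambda>i. hom_cat B E (X i)))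
      (\<lambda>h. \<lambda>i\<in>I. p i \<cdot>\<^bsub>B\<^esub> h) (\<lambda>\<alpha>. \<lambda>i\<in>I. lwhisk B (p i) \<alpha>))"

text \<open>Objects: arrows \<open>h\<close> with vertex \<open>E\<close> and a 2-cell \<open>\<mu> : f h \<Rightarrow> g h\<close>.\<close>

definition inserter_cone_cat :: "('o, 'a, 'c) twocat \<Rightarrow> 'a \<Rightarrow> 'a \<Rightarrow> 'o
    \<Rightarrow> ('a \<times> 'c, ('a \<times> 'c) \<times> 'c \<times> ('a \<times> 'c)) cat" where
  "inserter_cone_cat B f g E =
    (let Obs = {(h, \<mu>). h \<in> Mor B \<and> Dom B h = E \<and> Cod B h = Dom B f \<and>
           \<mu> \<in> Cell B \<and> Dom2 B \<mu> = f \<cdot>\<^bsub>B\<^esub> h \<and> Cod2 B \<mu> = g \<cdot>\<^bsub>B\<^esub> h}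
     in \<lparr>Ob = Obs,
         Mor = {((h, \<mu>), \<alpha>, (h', \<mu>')). (h, \<mu>) \<in> Obs \<and> (h', \<mu>') \<in> Obs \<and>
           \<alpha> \<in> Cell B \<and> Dom2 B \<alpha> = h \<and> Cod2 B \<alpha> = h' \<and>
           \<mu>' \<bullet>\<^bsub>B\<^esub> lwhisk B f \<alpha> = lwhisk B g \<alpha> \<bullet>\<^bsub>B\<^esub> \<mu>},
         Dom = (\<lambda>(x, \<alpha>, y). x),
         Cod = (\<lambda>(x, \<alpha>, y). y),
         Ide = (\<lambda>(h, \<mu>). ((h, \<mu>), Ide2 B h, (h, \<mu>))),
         Comp = (\<lambda>(y', \<beta>, z) (x, \<alpha>, y). (x, \<beta> \<bullet>\<^bsub>B\<^esub> \<alpha>, z))\<rparr>)"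

definition is_inserter :: "('o, 'a, 'c) twocat \<Rightarrow> 'a \<Rightarrow> 'a \<Rightarrow> 'o \<Rightarrow> 'a \<Rightarrow> 'c \<Rightarrow> bool" where
  "is_inserter B f g P p l \<longleftrightarrow>
    P \<in> Ob B \<and> (p, l) \<in> Ob (inserter_cone_cat B f g P) \<and>
    (\<forall>E\<in>Ob B. iso_functor (hom_cat B E P) (inserter_cone_cat B f g E)
      (\<lambda>h. (p \<cdot>\<^bsub>B\<^esub> h, rwhisk B l h))
      (\<lambda>\<alpha>. ((p \<cdot>\<^bsub>B\<^esub> Dom2 B \<alpha>, rwhisk B l (Dom2 B \<alpha>)), lwhisk B p \<alpha>,
            (p \<cdot>\<^bsub>B\<^esub> Cod2 B \<alpha>, rwhisk B l (Cod2 B \<alpha>)))))"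

definition equifier_cone_cat :: "('o, 'a, 'c) twocat \<Rightarrow> 'c \<Rightarrow> 'c \<Rightarrow> 'o \<Rightarrow> ('a, 'c) cat" where
  "equifier_cone_cat B \<alpha> \<beta> E =
    full_subcat (hom_cat B E (Dom B (Dom2 B \<alpha>))) {h. rwhisk B \<alpha> h = rwhisk B \<beta> h}"

definition is_equifier :: "('o, 'a, 'c) twocat \<Rightarrow> 'c \<Rightarrow> 'c \<Rightarrow> 'o \<Rightarrow> 'a \<Rightarrow> bool" where
  "is_equifier B \<alpha> \<beta> P p \<longleftrightarrow>
    P \<in> Ob B \<and> p \<in> Ob (equifier_cone_cat B \<alpha> \<beta> P) \<and>
    (\<forall>E\<in>Ob B. iso_functor (hom_cat B E P) (equifier_cone_cat B \<alpha> \<beta> E)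
      (\<lambda>h. p \<cdot>\<^bsub>B\<^esub> h) (\<lambda>\<gamma>. lwhisk B p \<gamma>))"

definition parallel :: "('o, 'a, 'c) twocat \<Rightarrow> 'a \<Rightarrow> 'a \<Rightarrow> bool" where
  "parallel B f g \<longleftrightarrow> f \<in> Mor B \<and> g \<in> Mor B \<and> Dom B f = Dom B g \<and> Cod B f = Cod B g"

definition parallel2 :: "('o, 'a, 'c) twocat \<Rightarrow> 'c \<Rightarrow> 'c \<Rightarrow> bool" where
  "parallel2 B \<alpha> \<beta> \<longleftrightarrow> \<alpha> \<in> Cell B \<and> \<beta> \<in> Cell B \<and> Dom2 B \<alpha> = Dom2 B \<beta> \<and> Cod2 B \<alpha> = Cod2 B \<beta>"

definition has_products :: "'i set \<Rightarrow> ('o, 'a, 'c) twocat \<Rightarrow> bool" where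
  "has_products U B \<longleftrightarrow> (\<forall>I\<subseteq>U. \<forall>X \<in> I \<rightarrow>\<^sub>E Ob B. \<exists>P p. is_product B I X P p)"

definition has_inserters :: "('o, 'a, 'c) twocat \<Rightarrow> bool" where
  "has_inserters B \<longleftrightarrow> (\<forall>f g. parallel B f g \<longrightarrow> (\<exists>P p l. is_inserter B f g P p l))"

definition has_equifiers :: "('o, 'a, 'c) twocat \<Rightarrow> bool" where
  "has_equifiers B \<longleftrightarrow> (\<forall>\<alpha> \<beta>. parallel2 B \<alpha> \<beta> \<longrightarrow> (\<exists>P p. is_equifier B \<alpha> \<beta> P p))"

text \<open>A choice of all these limits. Such a choice exists iff the limits exist
  (\<open>ex_PIE_choice\<close>); it is named so that one can speak of what is obtained by
  iterating the chosen limits: if every product cone counted as ``the'' product, then every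
  isomorphism into an object, being a unary product projection, would count as constructed.\<close>

record ('i, 'o, 'a, 'c) PIE_ops =
  Prod_ob :: "'i set \<Rightarrow> ('i \<Rightarrow> 'o) \<Rightarrow> 'o"
  Prod_pr :: "'i set \<Rightarrow> ('i \<Rightarrow> 'o) \<Rightarrow> 'i \<Rightarrow> 'a"
  Ins_ob :: "'a \<Rightarrow> 'a \<Rightarrow> 'o"
  Ins_arr :: "'a \<Rightarrow> 'a \<Rightarrow> 'a"
  Ins_cell :: "'a \<Rightarrow> 'a \<Rightarrow> 'c"
  Equ_ob :: "'c \<Rightarrow> 'c \<Rightarrow> 'o"
  Equ_arr :: "'c \<Rightarrow> 'c \<Rightarrow> 'a"

definition PIE_choice :: "'i set \<Rightarrow> ('o, 'a, 'c) twocat \<Rightarrow> ('i, 'o, 'a, 'c) PIE_ops \<Rightarrow> bool" where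
  "PIE_choice U B K \<longleftrightarrow>
    (\<forall>I\<subseteq>U. \<forall>X \<in> I \<rightarrow>\<^sub>E Ob B. is_product B I X (Prod_ob K I X) (Prod_pr K I X)) \<and>
    (\<forall>f g. parallel B f g \<longrightarrow> is_inserter B f g (Ins_ob K f g) (Ins_arr K f g) (Ins_cell K f g)) \<and>
    (\<forall>\<alpha> \<beta>. parallel2 B \<alpha> \<beta> \<longrightarrow> is_equifier B \<alpha> \<beta> (Equ_ob K \<alpha> \<beta>) (Equ_arr K \<alpha> \<beta>))"

lemma ex_PIE_choice:
  "(\<exists>K. PIE_choice U B K) \<longleftrightarrow> has_products U B \<and> has_inserters B \<and> has_equifiers B"
proof
  assume "\<exists>K. PIE_choice U B K"
  then show "has_products U B \<and> has_inserters B \<and> has_equifiers B"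
    unfolding PIE_choice_def has_products_def has_inserters_def has_equifiers_def by blast
next
  assume *: "has_products U B \<and> has_inserters B \<and> has_equifiers B"
  then obtain Po Pp where "\<forall>I\<subseteq>U. \<forall>X \<in> I \<rightarrow>\<^sub>E Ob B. is_product B I X (Po I X) (Pp I X)"
    unfolding has_products_def by metis
  moreover from * obtain Io Ia Ic where
    "\<forall>f g. parallel B f g \<longrightarrow> is_inserter B f g (Io f g) (Ia f g) (Ic f g)"
    unfolding has_inserters_def by metis
  moreover from * obtain Eo Ea where
    "\<forall>\<alpha> \<beta>. parallel2 B \<alpha> \<beta> \<longrightarrow> is_equifier B \<alpha> \<beta> (Eo \<alpha> \<beta>) (Ea \<alpha> \<beta>)"
    unfolding has_equifiers_def by metis
  ultimately have "PIE_choice U B \<lparr>Prod_ob = Po, Prod_pr = Pp, Ins_ob = Io, Ins_arr = Ia,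
      Ins_cell = Ic, Equ_ob = Eo, Equ_arr = Ea\<rparr>"
    by (simp add: PIE_choice_def)
  then show "\<exists>K. PIE_choice U B K" ..
qed


section \<open>Iterated products, inserters and equifiers\<close>

text \<open>The objects, arrows and 2-cells obtained from the diagram \<open>F\<close> by iterating the chosen
  limits: besides the image of \<open>F\<close>, the 2-category operations and the limits with their limit
  cones, these contain the arrows and 2-cells into a limit that are induced from already
  constructed ones by its universal property.\<close>

inductive PIE_ob and PIE_arr and PIE_cell
  for U :: "'i set" and B :: "('ob, 'ab, 'cb) twocat" and K :: "('i, 'ob, 'ab, 'cb) PIE_ops"
    and A :: "('oa, 'aa, 'ca) twocat" and F :: "('oa, 'aa, 'ca, 'ob, 'ab, 'cb) twofun"
where
  diag_ob: "X \<in> Ob A \<Longrightarrow> PIE_ob U B K A F (Fun0 F X)"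
| diag_arr: "f \<in> Mor A \<Longrightarrow> PIE_arr U B K A F (Fun1 F f)"
| diag_cell: "\<gamma> \<in> Cell A \<Longrightarrow> PIE_cell U B K A F (Fun2 F \<gamma>)"
| ide: "PIE_ob U B K A F X \<Longrightarrow> PIE_arr U B K A F (Ide B X)"
| comp: "\<lbrakk>PIE_arr U B K A F f; PIE_arr U B K A F g; Dom B g = Cod B f\<rbrakk>
    \<Longrightarrow> PIE_arr U B K A F (g \<cdot>\<^bsub>B\<^esub> f)"
| ide2: "PIE_arr U B K A F f \<Longrightarrow> PIE_cell U B K A F (Ide2 B f)"
| comp2: "\<lbrakk>PIE_cell U B K A F \<alpha>; PIE_cell U B K A F \<beta>; Dom2 B \<beta> = Cod2 B \<alpha>\<rbrakk>
    \<Longrightarrow> PIE_cell U B K A F (\<beta> \<bullet>\<^bsub>B\<^esub> \<alpha>)"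
| hcomp: "\<lbrakk>PIE_cell U B K A F \<alpha>; PIE_cell U B K A F \<beta>; Dom B (Dom2 B \<beta>) = Cod B (Dom2 B \<alpha>)\<rbrakk>
    \<Longrightarrow> PIE_cell U B K A F (\<beta> \<star>\<^bsub>B\<^esub> \<alpha>)"
| prod_ob: "\<lbrakk>I \<subseteq> U; X \<in> I \<rightarrow>\<^sub>E Ob B; \<forall>i\<in>I. PIE_ob U B K A F (X i)\<rbrakk>
    \<Longrightarrow> PIE_ob U B K A F (Prod_ob K I X)"
| prod_pr: "\<lbrakk>I \<subseteq> U; X \<in> I \<rightarrow>\<^sub>E Ob B; \<forall>i\<in>I. PIE_ob U B K A F (X i); i \<in> I\<rbrakk>
    \<Longrightarrow> PIE_arr U B K A F (Prod_pr K I X i)"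
| prod_arr: "\<lbrakk>I \<subseteq> U; X \<in> I \<rightarrow>\<^sub>E Ob B; \<forall>i\<in>I. PIE_ob U B K A F (X i);
      h \<in> Mor B; PIE_ob U B K A F (Dom B h); Cod B h = Prod_ob K I X;
      \<forall>i\<in>I. PIE_arr U B K A F (Prod_pr K I X i \<cdot>\<^bsub>B\<^esub> h)\<rbrakk>
    \<Longrightarrow> PIE_arr U B K A F h"
| prod_cell: "\<lbrakk>I \<subseteq> U; X \<in> I \<rightarrow>\<^sub>E Ob B; \<forall>i\<in>I. PIE_ob U B K A F (X i);
      \<alpha> \<in> Cell B; PIE_arr U B K A F (Dom2 B \<alpha>); PIE_arr U B K A F (Cod2 B \<alpha>);
      Cod B (Dom2 B \<alpha>) = Prod_ob K I X;
      \<forall>i\<in>I. PIE_cell U B K A F (lwhisk B (Prod_pr K I X i) \<alpha>)\<rbrakk>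
    \<Longrightarrow> PIE_cell U B K A F \<alpha>"
| ins_ob: "\<lbrakk>parallel B f g; PIE_arr U B K A F f; PIE_arr U B K A F g\<rbrakk>
    \<Longrightarrow> PIE_ob U B K A F (Ins_ob K f g)"
| ins_pr: "\<lbrakk>parallel B f g; PIE_arr U B K A F f; PIE_arr U B K A F g\<rbrakk>
    \<Longrightarrow> PIE_arr U B K A F (Ins_arr K f g)"
| ins_pr2: "\<lbrakk>parallel B f g; PIE_arr U B K A F f; PIE_arr U B K A F g\<rbrakk>
    \<Longrightarrow> PIE_cell U B K A F (Ins_cell K f g)"
| ins_arr: "\<lbrakk>parallel B f g; PIE_arr U B K A F f; PIE_arr U B K A F g;
      h \<in> Mor B; Cod B h = Ins_ob K f g;
      PIE_arr U B K A F (Ins_arr K f g \<cdot>\<^bsub>B\<^esub> h); PIE_cell U B K A F (rwhisk B (Ins_cell K f g) h)\<rbrakk>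
    \<Longrightarrow> PIE_arr U B K A F h"
| ins_cell: "\<lbrakk>parallel B f g; PIE_arr U B K A F f; PIE_arr U B K A F g;
      \<alpha> \<in> Cell B; PIE_arr U B K A F (Dom2 B \<alpha>); PIE_arr U B K A F (Cod2 B \<alpha>);
      Cod B (Dom2 B \<alpha>) = Ins_ob K f g; PIE_cell U B K A F (lwhisk B (Ins_arr K f g) \<alpha>)\<rbrakk>
    \<Longrightarrow> PIE_cell U B K A F \<alpha>"
| equ_ob: "\<lbrakk>parallel2 B \<alpha> \<beta>; PIE_cell U B K A F \<alpha>; PIE_cell U B K A F \<beta>\<rbrakk>
    \<Longrightarrow> PIE_ob U B K A F (Equ_ob K \<alpha> \<beta>)"
| equ_pr: "\<lbrakk>parallel2 B \<alpha> \<beta>; PIE_cell U B K A F \<alpha>; PIE_cell U B K A F \<beta>\<rbrakk>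
    \<Longrightarrow> PIE_arr U B K A F (Equ_arr K \<alpha> \<beta>)"
| equ_arr: "\<lbrakk>parallel2 B \<alpha> \<beta>; PIE_cell U B K A F \<alpha>; PIE_cell U B K A F \<beta>;
      h \<in> Mor B; Cod B h = Equ_ob K \<alpha> \<beta>; PIE_arr U B K A F (Equ_arr K \<alpha> \<beta> \<cdot>\<^bsub>B\<^esub> h)\<rbrakk>
    \<Longrightarrow> PIE_arr U B K A F h"
| equ_cell: "\<lbrakk>parallel2 B \<alpha> \<beta>; PIE_cell U B K A F \<alpha>; PIE_cell U B K A F \<beta>;
      \<gamma> \<in> Cell B; PIE_arr U B K A F (Dom2 B \<gamma>); PIE_arr U B K A F (Cod2 B \<gamma>);
      Cod B (Dom2 B \<gamma>) = Equ_ob K \<alpha> \<beta>; PIE_cell U B K A F (lwhisk B (Equ_arr K \<alpha> \<beta>) \<gamma>)\<rbrakk>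
    \<Longrightarrow> PIE_cell U B K A F \<gamma>"

end

theory Submission imports Defs begin

text \<open>Let \<open>z X\<close> be the initial object of the \<open>\<Sigma>\<close>-component of \<open>X\<close> and \<open>t X : z X \<rightarrow> X\<close> the unique
  arrow in \<open>\<Sigma>\<close>. A \<open>\<sigma>\<close>-s-cone \<open>\<theta>\<close> is an identity at \<open>t X\<close>, so its legs are determined by those at the
  initial objects: \<open>\<theta> X = F (t X) \<theta> (z X)\<close>. Hence the legs amount to an arrow into the product \<open>P\<close> of
  the \<open>F Z\<close> over all initial objects \<open>Z\<close>, and the 2-cells \<open>\<theta> f\<close> to a lift of it along the inserter of
  two arrows from \<open>P\<close> to the product of the \<open>F (cod f)\<close>. The remaining conditions (\<open>\<theta> f\<close> is an
  identity for \<open>f \<in> \<Sigma>\<close>, compatibility with composition and with 2-cells) are equations between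
  2-cells, imposed by equifiers.\<close>

section \<open>Functors and isomorphisms of categories\<close>

text \<open>Equifiers impose equations between 2-cells, and none of the three kinds of limit imposes
  an equation between arrows. Yet requiring \<open>\<theta> f\<close> to be an identity presupposes
  that its source and target arrows agree. Initiality removes this obstacle: for
  \<open>f \<in> S\<close>, the composite of \<open>f\<close> with \<open>t (Dom A f)\<close> is
  \<open>t (Cod A f)\<close>, so legs defined through \<open>t\<close> have agreeing arrows before
  any equation is imposed, and only an equation between parallel 2-cells remains.

  The second obstacle is size. An equifier treats one pair of 2-cells, so an infinite family of
  equations cannot be imposed one by one. Each family is tupled into a single pair of 2-cells into a
  product, which leaves finitely many equifiers to be composed.

  Constructibility is tracked next to the universal properties, since these are applied twice: to
  constructible data in order to build the limit, and to arbitrary cones in order to verify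
  it.\<close>

lemma iso_functor_bij:
  assumes "iso_functor C D Fo Fm"
  shows "bij_betw Fo (Ob C) (Ob D)" and "bij_betw Fm (Mor C) (Mor D)"
proof -
  from assms obtain Go Gm where *: "is_functor C D Fo Fm" "is_functor D C Go Gm"
    "\<forall>X\<in>Ob C. Go (Fo X) = X" "\<forall>f\<in>Mor C. Gm (Fm f) = f"
    "\<forall>Y\<in>Ob D. Fo (Go Y) = Y" "\<forall>g\<in>Mor D. Fm (Gm g) = g"
    unfolding iso_functor_def by blast
  show "bij_betw Fo (Ob C) (Ob D)"
    by (rule bij_betw_byWitness[where f' = Go]) (use * in \<open>auto simp: is_functor_def\<close>)
  show "bij_betw Fm (Mor C) (Mor D)"
    by (rule bij_betw_byWitness[where f' = Gm]) (use * in \<open>auto simp: is_functor_def\<close>)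
qed

lemma bij_betw_obtain:
  assumes "bij_betw f A B" "y \<in> B"
  obtains x where "x \<in> A" "f x = y"
  using assms unfolding bij_betw_def by blast

text \<open>The inverse functions are automatically functorial: each law is checked after applying
  the injective \<open>Fm\<close>. Isomorphisms onto cone categories thereby reduce to two
  bijections.\<close>

lemma iso_functorI:
  assumes C: "category C" and F: "is_functor C D Fo Fm"
    and o: "bij_betw Fo (Ob C) (Ob D)" and m: "bij_betw Fm (Mor C) (Mor D)"
  shows "iso_functor C D Fo Fm"
proof -
  interpret category C by (rule C)
  let ?Go = "inv_into (Ob C) Fo" and ?Gm = "inv_into (Mor C) Fm"
  have Go: "?Go Y \<in> Ob C" "Fo (?Go Y) = Y" if "Y \<in> Ob D" for Y
    using o that by (auto simp: bij_betw_def inv_into_into f_inv_into_f)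
  have Gm: "?Gm g \<in> Mor C" "Fm (?Gm g) = g" if "g \<in> Mor D" for g
    using m that by (auto simp: bij_betw_def inv_into_into f_inv_into_f)
  have GoFo: "?Go (Fo X) = X" if "X \<in> Ob C" for X
    using o that by (simp add: bij_betw_def)
  have GmFm: "?Gm (Fm f) = f" if "f \<in> Mor C" for f
    using m that by (simp add: bij_betw_def)
  have dc: "Dom C (?Gm g) = ?Go (Dom D g)" "Cod C (?Gm g) = ?Go (Cod D g)" if "g \<in> Mor D" for g
  proof -
    have "Dom D g = Fo (Dom C (?Gm g))" "Cod D g = Fo (Cod C (?Gm g))"
      using F Gm[OF that] unfolding is_functor_def by metis+
    then show "Dom C (?Gm g) = ?Go (Dom D g)" "Cod C (?Gm g) = ?Go (Cod D g)"
      using Gm[OF that] by (simp_all add: GoFo Dom_Ob Cod_Ob)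
  qed
  have ide: "?Gm (Ide D Y) = Ide C (?Go Y)" if "Y \<in> Ob D" for Y
  proof -
    have "Fm (Ide C (?Go Y)) = Ide D Y"
      using F Go[OF that] unfolding is_functor_def by metis
    then show ?thesis using GmFm[OF Ide_Mor[OF Go(1)[OF that]]] by simp
  qed
  have comp: "?Gm (g \<cdot>\<^bsub>D\<^esub> f) = ?Gm g \<cdot>\<^bsub>C\<^esub> ?Gm f"
    if "f \<in> Mor D" "g \<in> Mor D" "Dom D g = Cod D f" for f g
  proof -
    have d: "Dom C (?Gm g) = Cod C (?Gm f)" using that dc by simp
    have "Fm (?Gm g \<cdot>\<^bsub>C\<^esub> ?Gm f) = g \<cdot>\<^bsub>D\<^esub> f"
      using F Gm that d unfolding is_functor_def by metis
    then show ?thesis using GmFm[OF Comp_Mor[OF Gm(1) Gm(1) d]] that by simp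
  qed
  have "is_functor D C ?Go ?Gm"
    unfolding is_functor_def using Go Gm dc ide comp by blast
  then show ?thesis
    unfolding iso_functor_def using F Go Gm GoFo GmFm by blast
qed

lemma category_full_subcat:
  assumes "category C" shows "category (full_subcat C T)"
proof -
  interpret category C by (rule assms)
  show ?thesis
    by unfold_locales (auto simp: full_subcat_def Dom_Ob Cod_Ob Ide_Mor Dom_Ide Cod_Ide Comp_Mor
      Dom_Comp Cod_Comp Comp_Ide Ide_Comp Comp_assoc)
qed

section \<open>Whiskering\<close>

context two_category
begin

abbreviation lw (infixr "\<lhd>" 73) where "f \<lhd> \<alpha> \<equiv> lwhisk B f \<alpha>"
abbreviation rw (infixl "\<rhd>" 73) where "\<alpha> \<rhd> f \<equiv> rwhisk B \<alpha> f"

lemmas vert_simps = vert_cat_def cat.simps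

lemmas Dom2_Mor = vert.Dom_Ob[unfolded vert_simps]
lemmas Cod2_Mor = vert.Cod_Ob[unfolded vert_simps]
lemmas Ide2_Cell = vert.Ide_Mor[unfolded vert_simps]
lemmas Dom2_Ide2 = vert.Dom_Ide[unfolded vert_simps]
lemmas Cod2_Ide2 = vert.Cod_Ide[unfolded vert_simps]
lemmas Comp2_Cell = vert.Comp_Mor[unfolded vert_simps]
lemmas Dom2_Comp2 = vert.Dom_Comp[unfolded vert_simps]
lemmas Cod2_Comp2 = vert.Cod_Comp[unfolded vert_simps]
lemmas Comp2_Ide2 = vert.Comp_Ide[unfolded vert_simps]
lemmas Ide2_Comp2 = vert.Ide_Comp[unfolded vert_simps]

lemmas two_cat_simps [simp] =
  Dom_Ob Cod_Ob Ide_Mor Dom_Ide Cod_Ide Comp_Mor Dom_Comp Cod_Comp Comp_Ide Ide_Comp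
  Dom2_Mor Cod2_Mor Ide2_Cell Dom2_Ide2 Cod2_Ide2 Comp2_Cell Dom2_Comp2 Cod2_Comp2
  Comp2_Ide2 Ide2_Comp2 Dom_Cod2 Cod_Cod2

lemma Comp_Ide' [simp]: "f \<in> Mor B \<Longrightarrow> X = Dom B f \<Longrightarrow> f \<cdot> Ide B X = f"
  and Ide_Comp' [simp]: "f \<in> Mor B \<Longrightarrow> X = Cod B f \<Longrightarrow> Ide B X \<cdot> f = f"
  by auto

lemma Comp2_Ide2' [simp]: "\<alpha> \<in> Cell B \<Longrightarrow> f = Dom2 B \<alpha> \<Longrightarrow> \<alpha> \<bullet> Ide2 B f = \<alpha>"
  and Ide2_Comp2' [simp]: "\<alpha> \<in> Cell B \<Longrightarrow> f = Cod2 B \<alpha> \<Longrightarrow> Ide2 B f \<bullet> \<alpha> = \<alpha>"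
  by auto

lemma lwhisk_simps [simp]:
  assumes "f \<in> Mor B" "\<alpha> \<in> Cell B" "Dom B f = Cod B (Dom2 B \<alpha>)"
  shows "f \<lhd> \<alpha> \<in> Cell B" "Dom2 B (f \<lhd> \<alpha>) = f \<cdot> Dom2 B \<alpha>" "Cod2 B (f \<lhd> \<alpha>) = f \<cdot> Cod2 B \<alpha>"
  using assms by (simp_all add: lwhisk_def HComp_Cell Dom2_HComp Cod2_HComp)

lemma rwhisk_simps [simp]:
  assumes "f \<in> Mor B" "\<alpha> \<in> Cell B" "Dom B (Dom2 B \<alpha>) = Cod B f"
  shows "\<alpha> \<rhd> f \<in> Cell B" "Dom2 B (\<alpha> \<rhd> f) = Dom2 B \<alpha> \<cdot> f" "Cod2 B (\<alpha> \<rhd> f) = Cod2 B \<alpha> \<cdot> f"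
  using assms by (simp_all add: rwhisk_def HComp_Cell Dom2_HComp Cod2_HComp)

lemma lwhisk_Comp:
  "\<lbrakk>f \<in> Mor B; g \<in> Mor B; \<alpha> \<in> Cell B; Dom B f = Cod B (Dom2 B \<alpha>); Dom B g = Cod B f\<rbrakk>
    \<Longrightarrow> (g \<cdot> f) \<lhd> \<alpha> = g \<lhd> (f \<lhd> \<alpha>)"
  by (simp add: lwhisk_def HComp_assoc flip: HComp_Ide2)

lemma rwhisk_Comp:
  "\<lbrakk>f \<in> Mor B; g \<in> Mor B; \<alpha> \<in> Cell B; Dom B (Dom2 B \<alpha>) = Cod B g; Dom B g = Cod B f\<rbrakk>
    \<Longrightarrow> \<alpha> \<rhd> (g \<cdot> f) = (\<alpha> \<rhd> g) \<rhd> f"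
  by (simp add: rwhisk_def HComp_assoc flip: HComp_Ide2)

lemma lwhisk_rwhisk:
  "\<lbrakk>f \<in> Mor B; g \<in> Mor B; \<alpha> \<in> Cell B; Dom B (Dom2 B \<alpha>) = Cod B f; Dom B g = Cod B (Dom2 B \<alpha>)\<rbrakk>
    \<Longrightarrow> (g \<lhd> \<alpha>) \<rhd> f = g \<lhd> (\<alpha> \<rhd> f)"
  by (simp add: lwhisk_def rwhisk_def HComp_assoc)

lemma lwhisk_Comp2:
  "\<lbrakk>f \<in> Mor B; \<alpha> \<in> Cell B; \<beta> \<in> Cell B; Dom2 B \<beta> = Cod2 B \<alpha>; Dom B f = Cod B (Dom2 B \<alpha>)\<rbrakk>
    \<Longrightarrow> f \<lhd> (\<beta> \<bullet> \<alpha>) = (f \<lhd> \<beta>) \<bullet> (f \<lhd> \<alpha>)"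
  using interchange[of \<alpha> \<beta> "Ide2 B f" "Ide2 B f"] by (simp add: lwhisk_def)

lemma rwhisk_Comp2:
  "\<lbrakk>f \<in> Mor B; \<alpha> \<in> Cell B; \<beta> \<in> Cell B; Dom2 B \<beta> = Cod2 B \<alpha>; Dom B (Dom2 B \<alpha>) = Cod B f\<rbrakk>
    \<Longrightarrow> (\<beta> \<bullet> \<alpha>) \<rhd> f = (\<beta> \<rhd> f) \<bullet> (\<alpha> \<rhd> f)"
  using interchange[of "Ide2 B f" "Ide2 B f" \<alpha> \<beta>] by (simp add: rwhisk_def)

lemma lwhisk_Ide2: "\<lbrakk>f \<in> Mor B; g \<in> Mor B; Dom B g = Cod B f\<rbrakk> \<Longrightarrow> g \<lhd> Ide2 B f = Ide2 B (g \<cdot> f)"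
  and rwhisk_Ide2: "\<lbrakk>f \<in> Mor B; g \<in> Mor B; Dom B g = Cod B f\<rbrakk> \<Longrightarrow> Ide2 B g \<rhd> f = Ide2 B (g \<cdot> f)"
  by (simp_all add: lwhisk_def rwhisk_def HComp_Ide2)

lemma lwhisk_Ide [simp]: "\<alpha> \<in> Cell B \<Longrightarrow> X = Cod B (Dom2 B \<alpha>) \<Longrightarrow> Ide B X \<lhd> \<alpha> = \<alpha>"
  and rwhisk_Ide [simp]: "\<alpha> \<in> Cell B \<Longrightarrow> X = Dom B (Dom2 B \<alpha>) \<Longrightarrow> \<alpha> \<rhd> Ide B X = \<alpha>"
  by (simp_all add: lwhisk_def rwhisk_def Ide_HComp HComp_Ide)

text \<open>Both sides are \<open>\<beta> \<star> \<alpha>\<close>, computed by interchange after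
  composing each of the two 2-cells with an identity, on opposite sides.\<close>

lemma whisk_exchange:
  assumes "\<alpha> \<in> Cell B" "\<beta> \<in> Cell B" "Dom B (Dom2 B \<beta>) = Cod B (Dom2 B \<alpha>)"
  shows "(\<beta> \<rhd> Cod2 B \<alpha>) \<bullet> (Dom2 B \<beta> \<lhd> \<alpha>) = (Cod2 B \<beta> \<lhd> \<alpha>) \<bullet> (\<beta> \<rhd> Dom2 B \<alpha>)"
  using interchange[of \<alpha> "Ide2 B (Cod2 B \<alpha>)" "Ide2 B (Dom2 B \<beta>)" \<beta>]
    interchange[of "Ide2 B (Dom2 B \<alpha>)" \<alpha> \<beta> "Ide2 B (Cod2 B \<beta>)"] assms
  by (simp add: lwhisk_def rwhisk_def)

lemma category_hom_cat: "category (hom_cat B X Y)"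
  unfolding hom_cat_def by (rule category_full_subcat[OF vert.category_axioms])

lemma hom_cat_simps:
  "Ob (hom_cat B X Y) = {f \<in> Mor B. Dom B f = X \<and> Cod B f = Y}"
  "Mor (hom_cat B X Y) = {\<alpha> \<in> Cell B. Dom B (Dom2 B \<alpha>) = X \<and> Cod B (Dom2 B \<alpha>) = Y}"
  "Dom (hom_cat B X Y) = Dom2 B" "Cod (hom_cat B X Y) = Cod2 B"
  "Ide (hom_cat B X Y) = Ide2 B" "Comp (hom_cat B X Y) = Comp2 B"
  by (auto simp: hom_cat_def full_subcat_def vert_cat_def)

subsection \<open>Universal properties on elements\<close>

lemma is_product_iso:
  "is_product B I X P p \<Longrightarrow> E \<in> Ob B \<Longrightarrow>
    iso_functor (hom_cat B E P) (prod_cat I (\<lambda>i. hom_cat B E (X i)))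
      (\<lambda>h. \<lambda>i\<in>I. p i \<cdot> h) (\<lambda>\<alpha>. \<lambda>i\<in>I. p i \<lhd> \<alpha>)"
  unfolding is_product_def by (elim conjE bspec)

lemma is_inserter_iso:
  "is_inserter B f g P p l \<Longrightarrow> E \<in> Ob B \<Longrightarrow>
    iso_functor (hom_cat B E P) (inserter_cone_cat B f g E) (\<lambda>h. (p \<cdot> h, l \<rhd> h))
      (\<lambda>\<alpha>. ((p \<cdot> Dom2 B \<alpha>, l \<rhd> Dom2 B \<alpha>), p \<lhd> \<alpha>, (p \<cdot> Cod2 B \<alpha>, l \<rhd> Cod2 B \<alpha>)))"
  unfolding is_inserter_def by (elim conjE bspec)

lemma is_equifier_iso:
  "is_equifier B \<alpha> \<beta> P p \<Longrightarrow> E \<in> Ob B \<Longrightarrow>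
    iso_functor (hom_cat B E P) (equifier_cone_cat B \<alpha> \<beta> E) (\<lambda>h. p \<cdot> h) (\<lambda>\<gamma>. p \<lhd> \<gamma>)"
  unfolding is_equifier_def by (elim conjE bspec)

lemma product_arr:
  assumes "is_product B I X P p" "E \<in> Ob B"
    "\<And>i. i \<in> I \<Longrightarrow> x i \<in> Mor B \<and> Dom B (x i) = E \<and> Cod B (x i) = X i"
  obtains h where "h \<in> Mor B" "Dom B h = E" "Cod B h = P" "\<And>i. i \<in> I \<Longrightarrow> p i \<cdot> h = x i"
proof -
  have "bij_betw (\<lambda>h. \<lambda>i\<in>I. p i \<cdot> h) (Ob (hom_cat B E P)) (Ob (prod_cat I (\<lambda>i. hom_cat B E (X i))))"
    by (rule iso_functor_bij(1)[OF is_product_iso[OF assms(1)]]) (use assms in simp)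
  moreover have "restrict x I \<in> Ob (prod_cat I (\<lambda>i. hom_cat B E (X i)))"
    using assms(3) by (auto simp: prod_cat_def hom_cat_simps)
  ultimately obtain h where h: "h \<in> Ob (hom_cat B E P)" "(\<lambda>i\<in>I. p i \<cdot> h) = restrict x I"
    by (rule bij_betw_obtain)
  have "p i \<cdot> h = x i" if "i \<in> I" for i using that fun_cong[OF h(2), of i] by simp
  with h(1) that show ?thesis by (auto simp: hom_cat_simps)
qed

lemma product_arr_unique:
  assumes "is_product B I X P p" "h \<in> Mor B" "h' \<in> Mor B" "Dom B h = Dom B h'"
    "Cod B h = P" "Cod B h' = P" "\<And>i. i \<in> I \<Longrightarrow> p i \<cdot> h = p i \<cdot> h'"
  shows "h = h'"
proof -
  have "bij_betw (\<lambda>h. \<lambda>i\<in>I. p i \<cdot> h) (Ob (hom_cat B (Dom B h) P))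
      (Ob (prod_cat I (\<lambda>i. hom_cat B (Dom B h) (X i))))"
    by (rule iso_functor_bij(1)[OF is_product_iso[OF assms(1)]]) (use assms in simp)
  then have inj: "inj_on (\<lambda>h. \<lambda>i\<in>I. p i \<cdot> h) (Ob (hom_cat B (Dom B h) P))" by (simp add: bij_betw_def)
  show ?thesis
    by (rule inj_onD[OF inj]) (use assms in \<open>simp_all add: hom_cat_simps cong: restrict_cong\<close>)
qed

lemma product_cell_unique:
  assumes P: "is_product B I X P p" and "\<alpha> \<in> Cell B" "\<beta> \<in> Cell B" "Dom2 B \<alpha> = Dom2 B \<beta>"
    "Cod B (Dom2 B \<alpha>) = P" "\<And>i. i \<in> I \<Longrightarrow> p i \<lhd> \<alpha> = p i \<lhd> \<beta>"
  shows "\<alpha> = \<beta>"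
proof -
  let ?E = "Dom B (Dom2 B \<alpha>)"
  have "bij_betw (\<lambda>\<alpha>. \<lambda>i\<in>I. p i \<lhd> \<alpha>) (Mor (hom_cat B ?E P))
      (Mor (prod_cat I (\<lambda>i. hom_cat B ?E (X i))))"
    by (rule iso_functor_bij(2)[OF is_product_iso[OF assms(1)]]) (use assms in simp)
  then have inj: "inj_on (\<lambda>\<alpha>. \<lambda>i\<in>I. p i \<lhd> \<alpha>) (Mor (hom_cat B ?E P))" by (simp add: bij_betw_def)
  show ?thesis
    by (rule inj_onD[OF inj]) (use assms in \<open>simp_all add: hom_cat_simps cong: restrict_cong\<close>)
qed

text \<open>The comparison isomorphism only yields some 2-cell of the hom-category with components
  \<open>a\<close>. Its ends are identified with \<open>h\<close> and \<open>h'\<close> afterwards,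
  because they have the same projections. The inserter and equifier versions below recover the ends
  in the same way.\<close>

lemma product_cell:
  assumes P: "is_product B I X P p" and h: "h \<in> Mor B" "Cod B h = P" "h' \<in> Mor B" "Cod B h' = P"
    "Dom B h = Dom B h'"
    and a: "\<And>i. i \<in> I \<Longrightarrow> a i \<in> Cell B \<and> Dom2 B (a i) = p i \<cdot> h \<and> Cod2 B (a i) = p i \<cdot> h'"
  obtains \<alpha> where "\<alpha> \<in> Cell B" "Dom2 B \<alpha> = h" "Cod2 B \<alpha> = h'" "\<And>i. i \<in> I \<Longrightarrow> p i \<lhd> \<alpha> = a i"
proof -
  have p: "p i \<in> Mor B" "Dom B (p i) = P" "Cod B (p i) = X i" if "i \<in> I" for i
    using P that unfolding is_product_def by auto
  have "bij_betw (\<lambda>\<alpha>. \<lambda>i\<in>I. p i \<lhd> \<alpha>) (Mor (hom_cat B (Dom B h) P))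
      (Mor (prod_cat I (\<lambda>i. hom_cat B (Dom B h) (X i))))"
    by (rule iso_functor_bij(2)[OF is_product_iso[OF assms(1)]]) (use assms in simp)
  moreover have "restrict a I \<in> Mor (prod_cat I (\<lambda>i. hom_cat B (Dom B h) (X i)))"
    using a p h by (auto simp: prod_cat_def hom_cat_simps)
  ultimately obtain \<alpha> where \<alpha>: "\<alpha> \<in> Mor (hom_cat B (Dom B h) P)" "(\<lambda>i\<in>I. p i \<lhd> \<alpha>) = restrict a I"
    by (rule bij_betw_obtain)
  have eq: "p i \<lhd> \<alpha> = a i" if "i \<in> I" for i using that fun_cong[OF \<alpha>(2), of i] by simp
  have \<alpha>': "\<alpha> \<in> Cell B" "Dom B (Dom2 B \<alpha>) = Dom B h" "Cod B (Dom2 B \<alpha>) = P"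
    using \<alpha>(1) by (auto simp: hom_cat_simps)
  have eqs: "p i \<cdot> Dom2 B \<alpha> = p i \<cdot> h" "p i \<cdot> Cod2 B \<alpha> = p i \<cdot> h'" if "i \<in> I" for i
    using a[OF that] \<alpha>' p[OF that] lwhisk_simps[of "p i" \<alpha>] eq[OF that] by simp_all
  have "Dom2 B \<alpha> = h"
    by (rule product_arr_unique[OF P]) (simp_all add: h \<alpha>' eqs)
  moreover have "Cod2 B \<alpha> = h'"
    by (rule product_arr_unique[OF P]) (simp_all add: h \<alpha>' eqs)
  ultimately show ?thesis by (rule that[OF \<alpha>'(1) _ _ eq])
qed

lemma inserter_arr:
  assumes P: "is_inserter B f g P p l" and h: "h \<in> Mor B" "Cod B h = Dom B f"
    and \<mu>: "\<mu> \<in> Cell B" "Dom2 B \<mu> = f \<cdot> h" "Cod2 B \<mu> = g \<cdot> h"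
  obtains k where "k \<in> Mor B" "Dom B k = Dom B h" "Cod B k = P" "p \<cdot> k = h" "l \<rhd> k = \<mu>"
proof -
  have "bij_betw (\<lambda>h. (p \<cdot> h, l \<rhd> h)) (Ob (hom_cat B (Dom B h) P))
      (Ob (inserter_cone_cat B f g (Dom B h)))"
    by (rule iso_functor_bij(1)[OF is_inserter_iso[OF P]]) (use assms in simp)
  moreover have "(h, \<mu>) \<in> Ob (inserter_cone_cat B f g (Dom B h))"
    using h \<mu> by (simp add: inserter_cone_cat_def Let_def)
  ultimately obtain k where "k \<in> Ob (hom_cat B (Dom B h) P)" "(p \<cdot> k, l \<rhd> k) = (h, \<mu>)"
    by (rule bij_betw_obtain)
  then show ?thesis by (intro that[of k]) (simp_all add: hom_cat_simps)
qed

lemma inserter_arr_unique: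
  assumes P: "is_inserter B f g P p l" and "h \<in> Mor B" "h' \<in> Mor B" "Dom B h = Dom B h'"
    "Cod B h = P" "Cod B h' = P" "p \<cdot> h = p \<cdot> h'" "l \<rhd> h = l \<rhd> h'"
  shows "h = h'"
proof -
  have "bij_betw (\<lambda>h. (p \<cdot> h, l \<rhd> h)) (Ob (hom_cat B (Dom B h) P))
      (Ob (inserter_cone_cat B f g (Dom B h)))"
    by (rule iso_functor_bij(1)[OF is_inserter_iso[OF assms(1)]]) (use assms in simp)
  then have inj: "inj_on (\<lambda>h. (p \<cdot> h, l \<rhd> h)) (Ob (hom_cat B (Dom B h) P))" by (simp add: bij_betw_def)
  show ?thesis
    by (rule inj_onD[OF inj]) (use assms in \<open>simp_all add: hom_cat_simps\<close>)
qed

text \<open>Equality of codomains is assumed here, unlike for products and equifiers: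
  \<open>p \<lhd> \<alpha>\<close> fixes the composite of \<open>p\<close> with the codomain, but
  not \<open>l\<close> whiskered by the codomain, and the comparison isomorphism records
  both.\<close>

lemma inserter_cell_unique:
  assumes P: "is_inserter B f g P p l" and "\<alpha> \<in> Cell B" "\<beta> \<in> Cell B" "Dom2 B \<alpha> = Dom2 B \<beta>"
    "Cod2 B \<alpha> = Cod2 B \<beta>" "Cod B (Dom2 B \<alpha>) = P" "p \<lhd> \<alpha> = p \<lhd> \<beta>"
  shows "\<alpha> = \<beta>"
proof -
  let ?E = "Dom B (Dom2 B \<alpha>)"
  let ?H = "\<lambda>\<alpha>. ((p \<cdot> Dom2 B \<alpha>, l \<rhd> Dom2 B \<alpha>), p \<lhd> \<alpha>, (p \<cdot> Cod2 B \<alpha>, l \<rhd> Cod2 B \<alpha>))"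
  have "bij_betw ?H (Mor (hom_cat B ?E P)) (Mor (inserter_cone_cat B f g ?E))"
    by (rule iso_functor_bij(2)[OF is_inserter_iso[OF assms(1)]]) (use assms in simp)
  then have inj: "inj_on ?H (Mor (hom_cat B ?E P))" by (simp add: bij_betw_def)
  show ?thesis
    by (rule inj_onD[OF inj]) (use assms in \<open>simp_all add: hom_cat_simps\<close>)
qed

lemma is_inserterD:
  assumes "is_inserter B f g P p l"
  shows "P \<in> Ob B" "p \<in> Mor B" "Dom B p = P" "Cod B p = Dom B f"
    "l \<in> Cell B" "Dom2 B l = f \<cdot> p" "Cod2 B l = g \<cdot> p"
proof -
  have "P \<in> Ob B" "(p, l) \<in> Ob (inserter_cone_cat B f g P)"
    using assms unfolding is_inserter_def by blast+
  then show "P \<in> Ob B" "p \<in> Mor B" "Dom B p = P" "Cod B p = Dom B f"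
    "l \<in> Cell B" "Dom2 B l = f \<cdot> p" "Cod2 B l = g \<cdot> p"
    by (simp_all add: inserter_cone_cat_def Let_def)
qed

lemma inserter_cell:
  assumes P: "is_inserter B f g P p l" and fg: "parallel B f g"
    and h: "h \<in> Mor B" "Cod B h = P" "h' \<in> Mor B" "Cod B h' = P" "Dom B h = Dom B h'"
    and a: "a \<in> Cell B" "Dom2 B a = p \<cdot> h" "Cod2 B a = p \<cdot> h'"
    and eq: "(l \<rhd> h') \<bullet> (f \<lhd> a) = (g \<lhd> a) \<bullet> (l \<rhd> h)"
  obtains \<alpha> where "\<alpha> \<in> Cell B" "Dom2 B \<alpha> = h" "Cod2 B \<alpha> = h'" "p \<lhd> \<alpha> = a"
proof -
  let ?H = "\<lambda>\<alpha>. ((p \<cdot> Dom2 B \<alpha>, l \<rhd> Dom2 B \<alpha>), p \<lhd> \<alpha>, (p \<cdot> Cod2 B \<alpha>, l \<rhd> Cod2 B \<alpha>))"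
  note p = is_inserterD[OF P]
  have bij: "bij_betw ?H (Mor (hom_cat B (Dom B h) P)) (Mor (inserter_cone_cat B f g (Dom B h)))"
    by (rule iso_functor_bij(2)[OF is_inserter_iso[OF P]]) (use assms in simp)
  have "((p \<cdot> h, l \<rhd> h), a, (p \<cdot> h', l \<rhd> h')) \<in> Mor (inserter_cone_cat B f g (Dom B h))"
    using h p a eq fg by (auto simp: inserter_cone_cat_def Let_def parallel_def Comp_assoc)
  with bij obtain \<alpha> where \<alpha>: "\<alpha> \<in> Mor (hom_cat B (Dom B h) P)"
      "?H \<alpha> = ((p \<cdot> h, l \<rhd> h), a, (p \<cdot> h', l \<rhd> h'))"
    by (rule bij_betw_obtain)
  then have \<alpha>': "\<alpha> \<in> Cell B" "Dom B (Dom2 B \<alpha>) = Dom B h" "Cod B (Dom2 B \<alpha>) = P"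
    "p \<cdot> Dom2 B \<alpha> = p \<cdot> h" "p \<cdot> Cod2 B \<alpha> = p \<cdot> h'" "p \<lhd> \<alpha> = a"
    "l \<rhd> Dom2 B \<alpha> = l \<rhd> h" "l \<rhd> Cod2 B \<alpha> = l \<rhd> h'"
    by (simp_all add: hom_cat_simps)
  have "Dom2 B \<alpha> = h"
    by (rule inserter_arr_unique[OF P]) (simp_all add: h \<alpha>')
  moreover have "Cod2 B \<alpha> = h'"
    by (rule inserter_arr_unique[OF P]) (simp_all add: h \<alpha>')
  ultimately show ?thesis by (rule that[OF \<alpha>'(1) _ _ \<alpha>'(6)])
qed

lemma is_equifierD:
  assumes "is_equifier B \<alpha> \<beta> P p"
  shows "P \<in> Ob B" "p \<in> Mor B" "Dom B p = P" "Cod B p = Dom B (Dom2 B \<alpha>)" "\<alpha> \<rhd> p = \<beta> \<rhd> p"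
proof -
  have "P \<in> Ob B" "p \<in> Ob (equifier_cone_cat B \<alpha> \<beta> P)"
    using assms unfolding is_equifier_def by blast+
  then show "P \<in> Ob B" "p \<in> Mor B" "Dom B p = P" "Cod B p = Dom B (Dom2 B \<alpha>)" "\<alpha> \<rhd> p = \<beta> \<rhd> p"
    by (simp_all add: equifier_cone_cat_def full_subcat_def[of "hom_cat _ _ _"] hom_cat_simps)
qed

lemma equifier_arr:
  assumes P: "is_equifier B \<alpha> \<beta> P p" and h: "h \<in> Mor B" "Cod B h = Dom B (Dom2 B \<alpha>)"
    and eq: "\<alpha> \<rhd> h = \<beta> \<rhd> h"
  obtains k where "k \<in> Mor B" "Dom B k = Dom B h" "Cod B k = P" "p \<cdot> k = h"
proof -
  have "bij_betw (\<lambda>h. p \<cdot> h) (Ob (hom_cat B (Dom B h) P)) (Ob (equifier_cone_cat B \<alpha> \<beta> (Dom B h)))"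
    by (rule iso_functor_bij(1)[OF is_equifier_iso[OF P]]) (use assms in simp)
  moreover have "h \<in> Ob (equifier_cone_cat B \<alpha> \<beta> (Dom B h))"
    using h eq by (simp add: equifier_cone_cat_def full_subcat_def[of "hom_cat _ _ _"] hom_cat_simps)
  ultimately obtain k where "k \<in> Ob (hom_cat B (Dom B h) P)" "p \<cdot> k = h"
    by (rule bij_betw_obtain)
  then show ?thesis by (intro that[of k]) (simp_all add: hom_cat_simps)
qed

lemma equifier_arr_unique:
  assumes P: "is_equifier B \<alpha> \<beta> P p" and "h \<in> Mor B" "h' \<in> Mor B" "Dom B h = Dom B h'"
    "Cod B h = P" "Cod B h' = P" "p \<cdot> h = p \<cdot> h'"
  shows "h = h'"
proof -
  have "bij_betw (\<lambda>h. p \<cdot> h) (Ob (hom_cat B (Dom B h) P)) (Ob (equifier_cone_cat B \<alpha> \<beta> (Dom B h)))"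
    by (rule iso_functor_bij(1)[OF is_equifier_iso[OF P]]) (use assms in simp)
  then have inj: "inj_on (\<lambda>h. p \<cdot> h) (Ob (hom_cat B (Dom B h) P))" by (simp add: bij_betw_def)
  show ?thesis
    by (rule inj_onD[OF inj]) (use assms in \<open>simp_all add: hom_cat_simps\<close>)
qed

lemma equifier_cell_unique:
  assumes P: "is_equifier B \<alpha> \<beta> P p" and "\<gamma> \<in> Cell B" "\<delta> \<in> Cell B" "Dom2 B \<gamma> = Dom2 B \<delta>"
    "Cod B (Dom2 B \<gamma>) = P" "p \<lhd> \<gamma> = p \<lhd> \<delta>"
  shows "\<gamma> = \<delta>"
proof -
  let ?E = "Dom B (Dom2 B \<gamma>)"
  have "bij_betw (\<lambda>\<gamma>. p \<lhd> \<gamma>) (Mor (hom_cat B ?E P)) (Mor (equifier_cone_cat B \<alpha> \<beta> ?E))"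
    by (rule iso_functor_bij(2)[OF is_equifier_iso[OF P]]) (use assms in simp)
  then have inj: "inj_on (\<lambda>\<gamma>. p \<lhd> \<gamma>) (Mor (hom_cat B ?E P))" by (simp add: bij_betw_def)
  show ?thesis
    by (rule inj_onD[OF inj]) (use assms in \<open>simp_all add: hom_cat_simps\<close>)
qed

text \<open>In contrast to \<open>inserter_cell\<close>, nothing is asked of \<open>a\<close> beyond
  its ends: equifier cones form a full subcategory, so it suffices that both ends satisfy the
  equation, which is fact \<open>e\<close>.\<close>

lemma equifier_cell:
  assumes P: "is_equifier B \<alpha> \<beta> P p" and \<alpha>\<beta>: "parallel2 B \<alpha> \<beta>"
    and h: "h \<in> Mor B" "Cod B h = P" "h' \<in> Mor B" "Cod B h' = P" "Dom B h = Dom B h'"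
    and a: "a \<in> Cell B" "Dom2 B a = p \<cdot> h" "Cod2 B a = p \<cdot> h'"
  obtains \<gamma> where "\<gamma> \<in> Cell B" "Dom2 B \<gamma> = h" "Cod2 B \<gamma> = h'" "p \<lhd> \<gamma> = a"
proof -
  note p = is_equifierD[OF P]
  have e: "\<alpha> \<rhd> (p \<cdot> k) = \<beta> \<rhd> (p \<cdot> k)" if "k \<in> Mor B" "Cod B k = P" for k
    using that p \<alpha>\<beta> by (simp add: rwhisk_Comp parallel2_def)
  have "bij_betw (\<lambda>\<gamma>. p \<lhd> \<gamma>) (Mor (hom_cat B (Dom B h) P))
      (Mor (equifier_cone_cat B \<alpha> \<beta> (Dom B h)))"
    by (rule iso_functor_bij(2)[OF is_equifier_iso[OF P]]) (use assms in simp)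
  moreover have "a \<in> Mor (equifier_cone_cat B \<alpha> \<beta> (Dom B h))"
    using h p a e by (simp add: equifier_cone_cat_def full_subcat_def[of "hom_cat _ _ _"] hom_cat_simps)
  ultimately obtain \<gamma> where \<gamma>: "\<gamma> \<in> Mor (hom_cat B (Dom B h) P)" "p \<lhd> \<gamma> = a"
    by (rule bij_betw_obtain)
  then have \<gamma>': "\<gamma> \<in> Cell B" "Dom B (Dom2 B \<gamma>) = Dom B h" "Cod B (Dom2 B \<gamma>) = P"
    by (simp_all add: hom_cat_simps)
  have eqs: "p \<cdot> Dom2 B \<gamma> = p \<cdot> h" "p \<cdot> Cod2 B \<gamma> = p \<cdot> h'"
    using lwhisk_simps[of p \<gamma>] p \<gamma>' a \<gamma>(2) by simp_all
  have "Dom2 B \<gamma> = h"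
    by (rule equifier_arr_unique[OF P]) (simp_all add: h \<gamma>' eqs)
  moreover have "Cod2 B \<gamma> = h'"
    by (rule equifier_arr_unique[OF P]) (simp_all add: h \<gamma>' eqs)
  ultimately show ?thesis by (rule that[OF \<gamma>'(1) _ _ \<gamma>(2)])
qed

end

section \<open>Cones over a diagram\<close>

locale diagram = two_category B + A: two_category A
  for B :: "('ob, 'ab, 'cb) twocat" (structure) and A :: "('oa, 'aa, 'ca) twocat" +
  fixes F :: "('oa, 'aa, 'ca, 'ob, 'ab, 'cb) twofun"
  assumes F: "two_functor A B F"
begin

lemma Fun0_Ob [simp]: "X \<in> Ob A \<Longrightarrow> Fun0 F X \<in> Ob B"
  and Fun1_Mor [simp]: "f \<in> Mor A \<Longrightarrow> Fun1 F f \<in> Mor B"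
  and Dom_Fun1 [simp]: "f \<in> Mor A \<Longrightarrow> Dom B (Fun1 F f) = Fun0 F (Dom A f)"
  and Cod_Fun1 [simp]: "f \<in> Mor A \<Longrightarrow> Cod B (Fun1 F f) = Fun0 F (Cod A f)"
  and Fun1_Ide [simp]: "X \<in> Ob A \<Longrightarrow> Fun1 F (Ide A X) = Ide B (Fun0 F X)"
  and Fun1_Comp: "\<lbrakk>f \<in> Mor A; g \<in> Mor A; Dom A g = Cod A f\<rbrakk>
    \<Longrightarrow> Fun1 F (g \<cdot>\<^bsub>A\<^esub> f) = Fun1 F g \<cdot> Fun1 F f"
  and Fun2_Cell [simp]: "\<gamma> \<in> Cell A \<Longrightarrow> Fun2 F \<gamma> \<in> Cell B"
  and Dom2_Fun2 [simp]: "\<gamma> \<in> Cell A \<Longrightarrow> Dom2 B (Fun2 F \<gamma>) = Fun1 F (Dom2 A \<gamma>)"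
  and Cod2_Fun2 [simp]: "\<gamma> \<in> Cell A \<Longrightarrow> Cod2 B (Fun2 F \<gamma>) = Fun1 F (Cod2 A \<gamma>)"
  using F by (simp_all add: two_functor_def is_functor_def vert_cat_def)

lemma lax_coneD:
  assumes "lax_cone A B F E \<theta>"
  shows "X \<in> Ob A \<Longrightarrow> leg \<theta> X \<in> Mor B" "X \<in> Ob A \<Longrightarrow> Dom B (leg \<theta> X) = E"
    "X \<in> Ob A \<Longrightarrow> Cod B (leg \<theta> X) = Fun0 F X"
    "f \<in> Mor A \<Longrightarrow> tri \<theta> f \<in> Cell B"
    "f \<in> Mor A \<Longrightarrow> Dom2 B (tri \<theta> f) = Fun1 F f \<cdot> leg \<theta> (Dom A f)"
    "f \<in> Mor A \<Longrightarrow> Cod2 B (tri \<theta> f) = leg \<theta> (Cod A f)"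
    "X \<in> Ob A \<Longrightarrow> tri \<theta> (Ide A X) = Ide2 B (leg \<theta> X)"
    "\<lbrakk>f \<in> Mor A; g \<in> Mor A; Dom A g = Cod A f\<rbrakk>
      \<Longrightarrow> tri \<theta> (g \<cdot>\<^bsub>A\<^esub> f) = tri \<theta> g \<bullet> (Fun1 F g \<lhd> tri \<theta> f)"
    "\<gamma> \<in> Cell A \<Longrightarrow> tri \<theta> (Dom2 A \<gamma>) =
      tri \<theta> (Cod2 A \<gamma>) \<bullet> (Fun2 F \<gamma> \<rhd> leg \<theta> (Dom A (Dom2 A \<gamma>)))"
    "leg \<theta> \<in> extensional (Ob A)" "tri \<theta> \<in> extensional (Mor A)"
  using assms by (auto simp: lax_cone_def PiE_iff Pi_iff)

lemma lax_cone_precomp: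
  assumes \<pi>: "lax_cone A B F L \<pi>" and h: "h \<in> Mor B" "Cod B h = L"
  shows "lax_cone A B F (Dom B h) (cone_precomp A B \<pi> h)"
  using h by (simp add: lax_cone_def cone_precomp_def PiE_iff lax_coneD(1-6)[OF \<pi>] Comp_assoc
      lax_coneD(7)[OF \<pi>] rwhisk_Ide2 lax_coneD(8)[OF \<pi>] lax_coneD(9)[OF \<pi>]
      rwhisk_Comp2 rwhisk_Comp lwhisk_rwhisk)

lemma sigma_cone_simps:
  "\<theta> \<in> Ob (sigma_s_cone_cat A S B F E) \<longleftrightarrow>
    lax_cone A B F E \<theta> \<and> (\<forall>f\<in>S. tri \<theta> f \<in> Ide2 B ` Mor B)"
  "(\<theta>, \<alpha>, \<theta>') \<in> Mor (sigma_s_cone_cat A S B F E) \<longleftrightarrow>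
    \<theta> \<in> Ob (sigma_s_cone_cat A S B F E) \<and> \<theta>' \<in> Ob (sigma_s_cone_cat A S B F E) \<and>
    \<alpha> \<in> (\<Pi>\<^sub>E X\<in>Ob A. {\<mu> \<in> Cell B. Dom2 B \<mu> = leg \<theta> X \<and> Cod2 B \<mu> = leg \<theta>' X}) \<and>
    (\<forall>f\<in>Mor A. tri \<theta>' f \<bullet> (Fun1 F f \<lhd> \<alpha> (Dom A f)) = \<alpha> (Cod A f) \<bullet> tri \<theta> f)"
  "Dom (sigma_s_cone_cat A S B F E) (\<theta>, \<alpha>, \<theta>') = \<theta>"
  "Cod (sigma_s_cone_cat A S B F E) (\<theta>, \<alpha>, \<theta>') = \<theta>'"
  "Ide (sigma_s_cone_cat A S B F E) \<theta> = (\<theta>, \<lambda>X\<in>Ob A. Ide2 B (leg \<theta> X), \<theta>)"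
  "Comp (sigma_s_cone_cat A S B F E) (\<eta>, \<beta>, \<eta>') (\<theta>, \<alpha>, \<theta>') =
    (\<theta>, \<lambda>X\<in>Ob A. \<beta> X \<bullet> \<alpha> X, \<eta>')"
  by (auto simp: sigma_s_cone_cat_def full_subcat_def lax_cone_cat_def)

text \<open>An identity 2-cell has equal source and target, so the condition at \<open>f\<close>
  also contains an equation between arrows. Applied to the arrows \<open>t X\<close>, it determines
  all legs from those at the initial objects.\<close>

lemma sigma_cone_tri:
  assumes \<theta>: "\<theta> \<in> Ob (sigma_s_cone_cat A S B F E)" and f: "f \<in> S" "f \<in> Mor A"
  shows "tri \<theta> f = Ide2 B (leg \<theta> (Cod A f))" "Fun1 F f \<cdot> leg \<theta> (Dom A f) = leg \<theta> (Cod A f)"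
proof -
  have lax: "lax_cone A B F E \<theta>" using \<theta> by (simp add: sigma_cone_simps)
  obtain m where m: "m \<in> Mor B" "tri \<theta> f = Ide2 B m"
    using \<theta> f by (auto simp: sigma_cone_simps)
  have "leg \<theta> (Cod A f) = m" "Fun1 F f \<cdot> leg \<theta> (Dom A f) = m"
    using lax_coneD(5,6)[OF lax f(2)] m by simp_all
  then show "tri \<theta> f = Ide2 B (leg \<theta> (Cod A f))" "Fun1 F f \<cdot> leg \<theta> (Dom A f) = leg \<theta> (Cod A f)"
    using m by simp_all
qed

lemma sigma_cone_precomp:
  assumes \<pi>: "\<pi> \<in> Ob (sigma_s_cone_cat A S B F L)" and S: "S \<subseteq> Mor A"
    and h: "h \<in> Mor B" "Cod B h = L"
  shows "cone_precomp A B \<pi> h \<in> Ob (sigma_s_cone_cat A S B F (Dom B h))"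
proof -
  have lax: "lax_cone A B F L \<pi>" using \<pi> by (simp add: sigma_cone_simps)
  have "tri \<pi> f \<rhd> h \<in> Ide2 B ` Mor B" if "f \<in> S" for f
    using sigma_cone_tri(1)[OF \<pi> that] S that h lax_coneD(1,2)[OF lax] by (auto simp: rwhisk_Ide2)
  then show ?thesis
    using lax_cone_precomp[OF lax h] S by (auto simp: sigma_cone_simps(1) cone_precomp_def)
qed

lemma sigma_cone_precomp_functor:
  assumes \<pi>: "\<pi> \<in> Ob (sigma_s_cone_cat A S B F L)" and S: "S \<subseteq> Mor A"
  shows "is_functor (hom_cat B E L) (sigma_s_cone_cat A S B F E)
    (cone_precomp A B \<pi>) (cone_precomp2 A B \<pi>)"
proof -
  have lax: "lax_cone A B F L \<pi>" using \<pi> by (simp add: sigma_cone_simps)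
  note l = lax_coneD(1-6)[OF lax]
  \<comment> \<open>Naturality of the family induced by \<open>\<alpha>\<close> is the exchange law
    for \<open>\<alpha>\<close> and the triangle \<open>tri \<pi> f\<close>.\<close>
  have nat: "(tri \<pi> f \<rhd> Cod2 B \<alpha>) \<bullet> (Fun1 F f \<lhd> (leg \<pi> (Dom A f) \<lhd> \<alpha>)) =
      (leg \<pi> (Cod A f) \<lhd> \<alpha>) \<bullet> (tri \<pi> f \<rhd> Dom2 B \<alpha>)"
    if "f \<in> Mor A" "\<alpha> \<in> Cell B" "Cod B (Dom2 B \<alpha>) = L" for f \<alpha>
    using whisk_exchange[of \<alpha> "tri \<pi> f"] that l by (simp add: lwhisk_Comp)
  have mor: "cone_precomp2 A B \<pi> \<alpha> \<in> Mor (sigma_s_cone_cat A S B F E)"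
    if \<alpha>: "\<alpha> \<in> Cell B" "Dom B (Dom2 B \<alpha>) = E" "Cod B (Dom2 B \<alpha>) = L" for \<alpha>
    using sigma_cone_precomp[OF \<pi> S, of "Dom2 B \<alpha>"] sigma_cone_precomp[OF \<pi> S, of "Cod2 B \<alpha>"] \<alpha> l nat
    by (auto simp: cone_precomp2_def sigma_cone_simps(2) cone_precomp_def[of A B \<pi>])
  show ?thesis
    unfolding is_functor_def
  proof (intro conjI ballI impI)
    fix h assume "h \<in> Ob (hom_cat B E L)"
    then have h: "h \<in> Mor B" "Dom B h = E" "Cod B h = L" by (simp_all add: hom_cat_simps)
    show "cone_precomp A B \<pi> h \<in> Ob (sigma_s_cone_cat A S B F E)"
      using sigma_cone_precomp[OF \<pi> S h(1,3)] h by simp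
    show "cone_precomp2 A B \<pi> (Ide (hom_cat B E L) h) =
        Ide (sigma_s_cone_cat A S B F E) (cone_precomp A B \<pi> h)"
      using h l by (auto simp: cone_precomp2_def hom_cat_simps sigma_cone_simps lwhisk_Ide2
        cone_precomp_def[of A B \<pi>] intro!: restrict_ext)
  next
    fix \<alpha> assume "\<alpha> \<in> Mor (hom_cat B E L)"
    then have \<alpha>: "\<alpha> \<in> Cell B" "Dom B (Dom2 B \<alpha>) = E" "Cod B (Dom2 B \<alpha>) = L"
      by (simp_all add: hom_cat_simps)
    show "cone_precomp2 A B \<pi> \<alpha> \<in> Mor (sigma_s_cone_cat A S B F E)" by (rule mor[OF \<alpha>])
    show "Dom (sigma_s_cone_cat A S B F E) (cone_precomp2 A B \<pi> \<alpha>) =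
        cone_precomp A B \<pi> (Dom (hom_cat B E L) \<alpha>)"
      "Cod (sigma_s_cone_cat A S B F E) (cone_precomp2 A B \<pi> \<alpha>) =
        cone_precomp A B \<pi> (Cod (hom_cat B E L) \<alpha>)"
      by (simp_all add: cone_precomp2_def sigma_cone_simps hom_cat_simps)
  next
    fix \<alpha> \<beta> assume "\<alpha> \<in> Mor (hom_cat B E L)" "\<beta> \<in> Mor (hom_cat B E L)"
      "Dom (hom_cat B E L) \<beta> = Cod (hom_cat B E L) \<alpha>"
    then have *: "\<alpha> \<in> Cell B" "\<beta> \<in> Cell B" "Dom2 B \<beta> = Cod2 B \<alpha>" "Cod B (Dom2 B \<alpha>) = L"
      by (simp_all add: hom_cat_simps)
    then show "cone_precomp2 A B \<pi> (\<beta> \<cdot>\<^bsub>hom_cat B E L\<^esub> \<alpha>) =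
        cone_precomp2 A B \<pi> \<beta> \<cdot>\<^bsub>sigma_s_cone_cat A S B F E\<^esub> cone_precomp2 A B \<pi> \<alpha>"
      using l by (auto simp: cone_precomp2_def hom_cat_simps sigma_cone_simps lwhisk_Comp2
        intro!: restrict_ext)
  qed
qed

end

section \<open>Constructible objects, arrows and 2-cells\<close>

locale pie_setting = diagram B A F
  for B :: "('ob, 'ab, 'cb) twocat" (structure) and A :: "('oa, 'aa, 'ca) twocat"
    and F :: "('oa, 'aa, 'ca, 'ob, 'ab, 'cb) twofun" +
  fixes U :: "'i set" and K :: "('i, 'ob, 'ab, 'cb) PIE_ops"
  assumes K: "PIE_choice U B K"
begin

abbreviation "con_ob \<equiv> PIE_ob U B K A F"
abbreviation "con_arr \<equiv> PIE_arr U B K A F"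
abbreviation "con_cell \<equiv> PIE_cell U B K A F"

lemma choice_product:
  "I \<subseteq> U \<Longrightarrow> X \<in> I \<rightarrow>\<^sub>E Ob B \<Longrightarrow> is_product B I X (Prod_ob K I X) (Prod_pr K I X)"
  using K unfolding PIE_choice_def by blast

lemma choice_inserter:
  "parallel B f g \<Longrightarrow> is_inserter B f g (Ins_ob K f g) (Ins_arr K f g) (Ins_cell K f g)"
  using K unfolding PIE_choice_def by blast

lemma choice_equifier:
  "parallel2 B \<alpha> \<beta> \<Longrightarrow> is_equifier B \<alpha> \<beta> (Equ_ob K \<alpha> \<beta>) (Equ_arr K \<alpha> \<beta>)"
  using K unfolding PIE_choice_def by blast

text \<open>The ends of the universal arrows and 2-cells are read off the universal properties. For
  an arrow induced into an inserter or equifier, the domain is that of its composite with the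
  projection. For a product it is a premise of the rule, since an empty product has no projection to
  compose with.\<close>

lemma con_closed:
  "con_ob X \<Longrightarrow> X \<in> Ob B"
  "con_arr f \<Longrightarrow> f \<in> Mor B \<and> con_ob (Dom B f) \<and> con_ob (Cod B f)"
  "con_cell \<alpha> \<Longrightarrow> \<alpha> \<in> Cell B \<and> con_arr (Dom2 B \<alpha>) \<and> con_arr (Cod2 B \<alpha>) \<and>
    con_ob (Dom B (Dom2 B \<alpha>)) \<and> con_ob (Cod B (Dom2 B \<alpha>))"
proof (induction rule: PIE_ob_PIE_arr_PIE_cell.inducts)
  case (prod_ob I X)
  then show ?case using choice_product by (auto simp: is_product_def)
next
  case (prod_pr I X i)
  moreover have "con_ob (Prod_ob K I X)"
    using prod_pr by (intro PIE_ob_PIE_arr_PIE_cell.prod_ob) auto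
  ultimately show ?case using choice_product[of I X] by (auto simp: is_product_def)
next
  case (prod_arr I X h)
  moreover have "con_ob (Prod_ob K I X)"
    using prod_arr by (intro PIE_ob_PIE_arr_PIE_cell.prod_ob) auto
  ultimately show ?case by simp
next
  case (ins_ob f g)
  then show ?case using is_inserterD(1)[OF choice_inserter] by blast
next
  case (ins_pr f g)
  moreover have "con_ob (Ins_ob K f g)"
    using ins_pr by (intro PIE_ob_PIE_arr_PIE_cell.ins_ob) auto
  ultimately show ?case using is_inserterD[OF choice_inserter[of f g]] by simp
next
  case (ins_pr2 f g)
  moreover have "con_ob (Ins_ob K f g)" "con_arr (Ins_arr K f g)"
    using ins_pr2 by (auto intro: PIE_ob_PIE_arr_PIE_cell.ins_ob PIE_ob_PIE_arr_PIE_cell.ins_pr)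
  ultimately show ?case using is_inserterD[OF choice_inserter[of f g]]
    by (simp add: parallel_def PIE_ob_PIE_arr_PIE_cell.comp)
next
  case (ins_arr f g h)
  moreover have "con_ob (Ins_ob K f g)"
    using ins_arr by (intro PIE_ob_PIE_arr_PIE_cell.ins_ob) auto
  ultimately show ?case using is_inserterD[OF choice_inserter[of f g]] by simp
next
  case (equ_ob \<alpha> \<beta>)
  then show ?case using is_equifierD(1)[OF choice_equifier] by blast
next
  case (equ_pr \<alpha> \<beta>)
  moreover have "con_ob (Equ_ob K \<alpha> \<beta>)"
    using equ_pr by (intro PIE_ob_PIE_arr_PIE_cell.equ_ob) auto
  ultimately show ?case using is_equifierD[OF choice_equifier[of \<alpha> \<beta>]] by simp
next
  case (equ_arr \<alpha> \<beta> h)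
  moreover have "con_ob (Equ_ob K \<alpha> \<beta>)"
    using equ_arr by (intro PIE_ob_PIE_arr_PIE_cell.equ_ob) auto
  ultimately show ?case using is_equifierD[OF choice_equifier[of \<alpha> \<beta>]] by simp
qed (simp_all add: PIE_ob_PIE_arr_PIE_cell.intros(1-8) Dom2_HComp Cod2_HComp HComp_Cell)

lemma con_arrD:
  assumes "con_arr f" shows "f \<in> Mor B" "con_ob (Dom B f)" "con_ob (Cod B f)"
  using con_closed(2)[OF assms] by simp_all

lemma con_cellD:
  assumes "con_cell \<alpha>" shows "\<alpha> \<in> Cell B" "con_arr (Dom2 B \<alpha>)" "con_arr (Cod2 B \<alpha>)"
  using con_closed(3)[OF assms] by simp_all

lemma con_lwhisk:
  "con_arr f \<Longrightarrow> con_cell \<alpha> \<Longrightarrow> Dom B f = Cod B (Dom2 B \<alpha>) \<Longrightarrow> con_cell (f \<lhd> \<alpha>)"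
  by (simp add: lwhisk_def PIE_ob_PIE_arr_PIE_cell.hcomp PIE_ob_PIE_arr_PIE_cell.ide2 con_arrD)

lemma con_rwhisk:
  "con_arr f \<Longrightarrow> con_cell \<alpha> \<Longrightarrow> Dom B (Dom2 B \<alpha>) = Cod B f \<Longrightarrow> con_cell (\<alpha> \<rhd> f)"
  by (simp add: rwhisk_def PIE_ob_PIE_arr_PIE_cell.hcomp PIE_ob_PIE_arr_PIE_cell.ide2 con_arrD)

section \<open>Joint equifiers of families of equations\<close>

text \<open>The families needed here are indexed by objects, arrows or 2-cells of \<open>A\<close>,
  whereas \<open>K\<close> chooses products over subsets of \<open>U\<close>. This is a chosen
  product reindexed along a bijection \<open>\<phi>\<close>. The chosen product itself is kept,
  because constructibility is defined only for the choices of \<open>K\<close>.\<close>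

definition con_product :: "'j set \<Rightarrow> ('j \<Rightarrow> 'ob) \<Rightarrow> 'ob \<Rightarrow> ('j \<Rightarrow> 'ab) \<Rightarrow> bool" where
  "con_product J X P p \<longleftrightarrow> (\<exists>I Y \<phi>. I \<subseteq> U \<and> Y \<in> I \<rightarrow>\<^sub>E Ob B \<and> (\<forall>i\<in>I. con_ob (Y i)) \<and>
    bij_betw \<phi> J I \<and> (\<forall>j\<in>J. X j = Y (\<phi> j)) \<and> P = Prod_ob K I Y \<and>
    (\<forall>j\<in>J. p j = Prod_pr K I Y (\<phi> j)))"

lemma ex_con_product:
  fixes J :: "'j set"
  assumes "J \<lesssim> U" "\<And>j. j \<in> J \<Longrightarrow> con_ob (X j)"
  obtains P p where "con_product J X P p"
proof -
  obtain \<phi> where \<phi>: "inj_on \<phi> J" "\<phi> ` J \<subseteq> U"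
    using assms(1) by (auto simp: lepoll_def)
  define Y where "Y = (\<lambda>i\<in>\<phi> ` J. X (inv_into J \<phi> i))"
  have Y: "Y (\<phi> j) = X j" if "j \<in> J" for j
    using that \<phi> by (simp add: Y_def)
  have "Y \<in> \<phi> ` J \<rightarrow>\<^sub>E Ob B"
    using \<phi> assms(2) by (auto simp: Y_def con_closed(1))
  moreover have "\<forall>i\<in>\<phi> ` J. con_ob (Y i)" using Y assms(2) by simp
  ultimately have "con_product J X (Prod_ob K (\<phi> ` J) Y) (\<lambda>j. Prod_pr K (\<phi> ` J) Y (\<phi> j))"
    unfolding con_product_def using \<phi> Y
    by (intro exI[of _ "\<phi> ` J"] exI[of _ Y] exI[of _ \<phi>]) (simp add: bij_betw_def)
  then show ?thesis by (rule that)
qed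

lemma con_productE:
  assumes "con_product J X P p"
  obtains I Y \<phi> where "I \<subseteq> U" "Y \<in> I \<rightarrow>\<^sub>E Ob B" "\<forall>i\<in>I. con_ob (Y i)" "bij_betw \<phi> J I"
    "\<And>j. j \<in> J \<Longrightarrow> X j = Y (\<phi> j)" "P = Prod_ob K I Y" "\<And>j. j \<in> J \<Longrightarrow> p j = Prod_pr K I Y (\<phi> j)"
    "is_product B I Y P (Prod_pr K I Y)"
    "\<And>j. j \<in> J \<Longrightarrow> \<phi> j \<in> I" "\<And>i. i \<in> I \<Longrightarrow> \<exists>j\<in>J. i = \<phi> j"
proof -
  from assms obtain I Y \<phi> where *: "I \<subseteq> U" "Y \<in> I \<rightarrow>\<^sub>E Ob B" "\<forall>i\<in>I. con_ob (Y i)" "bij_betw \<phi> J I"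
    "\<forall>j\<in>J. X j = Y (\<phi> j)" "P = Prod_ob K I Y" "\<forall>j\<in>J. p j = Prod_pr K I Y (\<phi> j)"
    unfolding con_product_def by blast
  moreover have "is_product B I Y P (Prod_pr K I Y)" using choice_product * by simp
  moreover have "\<phi> j \<in> I" if "j \<in> J" for j using *(4) that by (auto simp: bij_betw_def)
  moreover have "\<exists>j\<in>J. i = \<phi> j" if "i \<in> I" for i using *(4) that by (auto simp: bij_betw_def)
  ultimately show ?thesis by (intro that) simp_all
qed

lemma con_product_simps:
  assumes "con_product J X P p"
  shows "con_ob P" "\<And>j. j \<in> J \<Longrightarrow> con_arr (p j)" "\<And>j. j \<in> J \<Longrightarrow> p j \<in> Mor B"
    "\<And>j. j \<in> J \<Longrightarrow> Dom B (p j) = P" "\<And>j. j \<in> J \<Longrightarrow> Cod B (p j) = X j"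
proof -
  from assms obtain I Y \<phi> where *: "I \<subseteq> U" "Y \<in> I \<rightarrow>\<^sub>E Ob B" "\<forall>i\<in>I. con_ob (Y i)" "bij_betw \<phi> J I"
    "\<And>j. j \<in> J \<Longrightarrow> X j = Y (\<phi> j)" "P = Prod_ob K I Y" "\<And>j. j \<in> J \<Longrightarrow> p j = Prod_pr K I Y (\<phi> j)"
    "is_product B I Y P (Prod_pr K I Y)"
    "\<And>j. j \<in> J \<Longrightarrow> \<phi> j \<in> I"
    by (rule con_productE) blast
  show "con_ob P" using * by (auto intro: PIE_ob_PIE_arr_PIE_cell.prod_ob)
  fix j assume j: "j \<in> J"
  show "con_arr (p j)" using * j by (auto intro: PIE_ob_PIE_arr_PIE_cell.prod_pr)
  show "p j \<in> Mor B" "Dom B (p j) = P" "Cod B (p j) = X j"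
    using *(5,7-9) j by (auto simp: is_product_def)
qed

text \<open>Constructibility of \<open>h\<close> is a conditional last clause, so that the same fact
  serves constructible families and the arbitrary test data of a universal property.\<close>

lemma con_product_arr:
  assumes P: "con_product J X P p" and "E \<in> Ob B"
    "\<And>j. j \<in> J \<Longrightarrow> x j \<in> Mor B \<and> Dom B (x j) = E \<and> Cod B (x j) = X j"
  obtains h where "h \<in> Mor B" "Dom B h = E" "Cod B h = P" "\<And>j. j \<in> J \<Longrightarrow> p j \<cdot> h = x j"
    "con_ob E \<Longrightarrow> (\<And>j. j \<in> J \<Longrightarrow> con_arr (x j)) \<Longrightarrow> con_arr h"
proof -
  from P obtain I Y \<phi> where *: "I \<subseteq> U" "Y \<in> I \<rightarrow>\<^sub>E Ob B" "\<forall>i\<in>I. con_ob (Y i)" "bij_betw \<phi> J I"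
    "\<And>j. j \<in> J \<Longrightarrow> X j = Y (\<phi> j)" "P = Prod_ob K I Y" "\<And>j. j \<in> J \<Longrightarrow> p j = Prod_pr K I Y (\<phi> j)"
    "is_product B I Y P (Prod_pr K I Y)"
    "\<And>j. j \<in> J \<Longrightarrow> \<phi> j \<in> I" "\<And>i. i \<in> I \<Longrightarrow> \<exists>j\<in>J. i = \<phi> j"
    by (rule con_productE) blast
  let ?\<psi> = "inv_into J \<phi>"
  have inv: "?\<psi> (\<phi> j) = j" if "j \<in> J" for j using *(4) that by (simp add: bij_betw_def)
  have "x (?\<psi> i) \<in> Mor B \<and> Dom B (x (?\<psi> i)) = E \<and> Cod B (x (?\<psi> i)) = Y i" if "i \<in> I" for i
    using *(10)[OF that] assms(3) *(5) inv by auto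
  from product_arr[OF *(8) assms(2) this]
  obtain h where h: "h \<in> Mor B" "Dom B h = E" "Cod B h = P"
    "\<And>i. i \<in> I \<Longrightarrow> Prod_pr K I Y i \<cdot> h = x (?\<psi> i)" by blast
  have px: "p j \<cdot> h = x j" if "j \<in> J" for j
    using h(4)[OF *(9)[OF that]] *(7)[OF that] inv[OF that] by simp
  have con: "con_arr h" if c: "con_ob E" "\<And>j. j \<in> J \<Longrightarrow> con_arr (x j)"
  proof (rule PIE_ob_PIE_arr_PIE_cell.prod_arr)
    show "\<forall>i\<in>I. con_arr (Prod_pr K I Y i \<cdot> h)"
      using h(4) c(2) *(10) inv by fastforce
  qed (use * h c in auto)
  show ?thesis by (rule that[OF h(1-3) px con])
qed

lemma con_product_arr_unique:
  assumes P: "con_product J X P p" and "h \<in> Mor B" "h' \<in> Mor B" "Dom B h = Dom B h'"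
    "Cod B h = P" "Cod B h' = P" and eq: "\<And>j. j \<in> J \<Longrightarrow> p j \<cdot> h = p j \<cdot> h'"
  shows "h = h'"
proof -
  from P obtain I Y \<phi> where *: "bij_betw \<phi> J I" "\<And>j. j \<in> J \<Longrightarrow> p j = Prod_pr K I Y (\<phi> j)"
    "is_product B I Y P (Prod_pr K I Y)" "\<And>i. i \<in> I \<Longrightarrow> \<exists>j\<in>J. i = \<phi> j"
    by (rule con_productE) blast
  have "Prod_pr K I Y i \<cdot> h = Prod_pr K I Y i \<cdot> h'" if "i \<in> I" for i
    using *(4)[OF that] *(2) eq by auto
  from product_arr_unique[OF *(3) assms(2-6) this] show ?thesis .
qed

lemma con_product_cell:
  assumes P: "con_product J X P p" and h: "h \<in> Mor B" "Cod B h = P" "h' \<in> Mor B" "Cod B h' = P"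
    "Dom B h = Dom B h'"
    and a: "\<And>j. j \<in> J \<Longrightarrow> a j \<in> Cell B \<and> Dom2 B (a j) = p j \<cdot> h \<and> Cod2 B (a j) = p j \<cdot> h'"
  obtains \<alpha> where "\<alpha> \<in> Cell B" "Dom2 B \<alpha> = h" "Cod2 B \<alpha> = h'" "\<And>j. j \<in> J \<Longrightarrow> p j \<lhd> \<alpha> = a j"
    "con_arr h \<Longrightarrow> con_arr h' \<Longrightarrow> (\<And>j. j \<in> J \<Longrightarrow> con_cell (a j)) \<Longrightarrow> con_cell \<alpha>"
proof -
  from P obtain I Y \<phi> where *: "I \<subseteq> U" "Y \<in> I \<rightarrow>\<^sub>E Ob B" "\<forall>i\<in>I. con_ob (Y i)" "bij_betw \<phi> J I"
    "\<And>j. j \<in> J \<Longrightarrow> X j = Y (\<phi> j)" "P = Prod_ob K I Y" "\<And>j. j \<in> J \<Longrightarrow> p j = Prod_pr K I Y (\<phi> j)"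
    "is_product B I Y P (Prod_pr K I Y)"
    "\<And>j. j \<in> J \<Longrightarrow> \<phi> j \<in> I" "\<And>i. i \<in> I \<Longrightarrow> \<exists>j\<in>J. i = \<phi> j"
    by (rule con_productE) blast
  let ?\<psi> = "inv_into J \<phi>"
  have inv: "?\<psi> (\<phi> j) = j" if "j \<in> J" for j using *(4) that by (simp add: bij_betw_def)
  have "a (?\<psi> i) \<in> Cell B \<and> Dom2 B (a (?\<psi> i)) = Prod_pr K I Y i \<cdot> h \<and>
      Cod2 B (a (?\<psi> i)) = Prod_pr K I Y i \<cdot> h'" if "i \<in> I" for i
    using *(10)[OF that] a *(7) inv by auto
  from product_cell[OF *(8) h this]
  obtain \<alpha> where \<alpha>: "\<alpha> \<in> Cell B" "Dom2 B \<alpha> = h" "Cod2 B \<alpha> = h'"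
    "\<And>i. i \<in> I \<Longrightarrow> Prod_pr K I Y i \<lhd> \<alpha> = a (?\<psi> i)" by blast
  have pa: "p j \<lhd> \<alpha> = a j" if "j \<in> J" for j
    using \<alpha>(4)[OF *(9)[OF that]] *(7)[OF that] inv[OF that] by simp
  have con: "con_cell \<alpha>" if c: "con_arr h" "con_arr h'" "\<And>j. j \<in> J \<Longrightarrow> con_cell (a j)"
  proof (rule PIE_ob_PIE_arr_PIE_cell.prod_cell)
    show "\<forall>i\<in>I. con_cell (Prod_pr K I Y i \<lhd> \<alpha>)"
      using \<alpha>(4) c(3) *(10) inv by fastforce
  qed (use * \<alpha> h c in auto)
  show ?thesis by (rule that[OF \<alpha>(1-3) pa con])
qed

lemma con_product_cell_unique:
  assumes P: "con_product J X P p" and "\<alpha> \<in> Cell B" "\<beta> \<in> Cell B" "Dom2 B \<alpha> = Dom2 B \<beta>"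
    "Cod B (Dom2 B \<alpha>) = P" and eq: "\<And>j. j \<in> J \<Longrightarrow> p j \<lhd> \<alpha> = p j \<lhd> \<beta>"
  shows "\<alpha> = \<beta>"
proof -
  from P obtain I Y \<phi> where *: "bij_betw \<phi> J I" "\<And>j. j \<in> J \<Longrightarrow> p j = Prod_pr K I Y (\<phi> j)"
    "is_product B I Y P (Prod_pr K I Y)" "\<And>i. i \<in> I \<Longrightarrow> \<exists>j\<in>J. i = \<phi> j"
    by (rule con_productE) blast
  have "Prod_pr K I Y i \<lhd> \<alpha> = Prod_pr K I Y i \<lhd> \<beta>" if "i \<in> I" for i
    using *(4)[OF that] *(2) eq by auto
  from product_cell_unique[OF *(3) assms(2-5) this] show ?thesis .
qed

section \<open>Equations between constructible 2-cells, merged and jointly equified\<close>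

definition equation :: "'ob \<Rightarrow> 'cb \<times> 'cb \<Rightarrow> bool" where
  "equation P c \<longleftrightarrow> parallel2 B (fst c) (snd c) \<and> Dom B (Dom2 B (fst c)) = P \<and>
    con_cell (fst c) \<and> con_cell (snd c)"

definition solves :: "'ab \<Rightarrow> 'cb \<times> 'cb \<Rightarrow> bool" where
  "solves h c \<longleftrightarrow> fst c \<rhd> h = snd c \<rhd> h"

text \<open>The left sides are tupled into one 2-cell into the product of the target objects, and so
  are the right sides. Since 2-cells into a product are equal as soon as their projections are, the
  merged equation is the conjunction of the given ones.\<close>

lemma ex_merged_equation:
  fixes J :: "'j set"
  assumes J: "J \<lesssim> U" and P: "con_ob P" and eqs: "\<And>j. j \<in> J \<Longrightarrow> equation P (c j)"
  shows "\<exists>d. equation P d \<and>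
    (\<forall>h\<in>Mor B. Cod B h = P \<longrightarrow> solves h d \<longleftrightarrow> (\<forall>j\<in>J. solves h (c j)))"
proof -
  have c: "fst (c j) \<in> Cell B" "snd (c j) \<in> Cell B" "Dom2 B (snd (c j)) = Dom2 B (fst (c j))"
    "Cod2 B (snd (c j)) = Cod2 B (fst (c j))" "Dom B (Dom2 B (fst (c j))) = P"
    "con_cell (fst (c j))" "con_cell (snd (c j))"
    "con_arr (Dom2 B (fst (c j)))" "con_arr (Cod2 B (fst (c j)))"
    "con_ob (Cod B (Dom2 B (fst (c j))))"
    if "j \<in> J" for j
    using eqs[OF that] by (auto simp: equation_def parallel2_def con_cellD con_closed(3))
  obtain Q q where Q: "con_product J (\<lambda>j. Cod B (Dom2 B (fst (c j)))) Q q"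
    by (rule ex_con_product[OF J c(10)])
  note q = con_product_simps[OF Q]
  have PB: "P \<in> Ob B" by (rule con_closed(1)[OF P])
  \<comment> \<open>The merged sides have to be parallel, so the common sources of the pairs are
    tupled into \<open>u\<close> and their common targets into \<open>v\<close> before the 2-cells
    themselves are tupled.\<close>
  obtain u where u: "u \<in> Mor B" "Dom B u = P" "Cod B u = Q"
    "\<And>j. j \<in> J \<Longrightarrow> q j \<cdot> u = Dom2 B (fst (c j))" "con_arr u"
    by (rule con_product_arr[OF Q PB, of "\<lambda>j. Dom2 B (fst (c j))"]) (use c P in auto)
  obtain v where v: "v \<in> Mor B" "Dom B v = P" "Cod B v = Q"
    "\<And>j. j \<in> J \<Longrightarrow> q j \<cdot> v = Cod2 B (fst (c j))" "con_arr v"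
    by (rule con_product_arr[OF Q PB, of "\<lambda>j. Cod2 B (fst (c j))"]) (use c P in auto)
  obtain a where a: "a \<in> Cell B" "Dom2 B a = u" "Cod2 B a = v"
    "\<And>j. j \<in> J \<Longrightarrow> q j \<lhd> a = fst (c j)" "con_cell a"
    by (rule con_product_cell[OF Q u(1,3) v(1,3), of "\<lambda>j. fst (c j)"]) (use c u v in auto)
  obtain b where b: "b \<in> Cell B" "Dom2 B b = u" "Cod2 B b = v"
    "\<And>j. j \<in> J \<Longrightarrow> q j \<lhd> b = snd (c j)" "con_cell b"
    by (rule con_product_cell[OF Q u(1,3) v(1,3), of "\<lambda>j. snd (c j)"]) (use c u v in auto)
  have "equation P (a, b)" using a b u by (simp add: equation_def parallel2_def)
  moreover have "solves h (a, b) \<longleftrightarrow> (\<forall>j\<in>J. solves h (c j))" if h: "h \<in> Mor B" "Cod B h = P" for h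
  proof -
    \<comment> \<open>Restriction along \<open>h\<close> commutes with the projections, so solving
      can be tested componentwise.\<close>
    have w: "fst (c j) \<rhd> h = q j \<lhd> (a \<rhd> h)" "snd (c j) \<rhd> h = q j \<lhd> (b \<rhd> h)" if "j \<in> J" for j
      using a b q u that h by (simp_all flip: lwhisk_rwhisk)
    have "a \<rhd> h = b \<rhd> h" if "\<forall>j\<in>J. solves h (c j)"
      by (rule con_product_cell_unique[OF Q]) (use that w a b u h in \<open>auto simp: solves_def\<close>)
    then show ?thesis using w by (auto simp: solves_def)
  qed
  ultimately show ?thesis by blast
qed

text \<open>The universal property is spelled out on elements: solutions factor through
  \<open>e\<close>, and composition with \<open>e\<close> is injective on arrows and full and
  faithful on 2-cells. In this form it passes to composites, which matters because a joint equifier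
  is obtained as a composite of chosen equifiers and need not itself be one chosen by
  \<open>K\<close>.\<close>

definition joint_equifier :: "'ob \<Rightarrow> ('cb \<times> 'cb) set \<Rightarrow> 'ab \<Rightarrow> bool" where
  "joint_equifier P C e \<longleftrightarrow> con_arr e \<and> Cod B e = P \<and> (\<forall>c\<in>C. solves e c) \<and>
    (\<forall>h\<in>Mor B. Cod B h = P \<longrightarrow> (\<forall>c\<in>C. solves h c) \<longrightarrow>
      (\<exists>k\<in>Mor B. Dom B k = Dom B h \<and> Cod B k = Dom B e \<and> e \<cdot> k = h)) \<and>
    (\<forall>k\<in>Mor B. \<forall>k'\<in>Mor B. Dom B k = Dom B k' \<longrightarrow> Cod B k = Dom B e \<longrightarrow> Cod B k' = Dom B e \<longrightarrow>
      (e \<cdot> k = e \<cdot> k' \<longrightarrow> k = k') \<and>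
      (\<forall>a\<in>Cell B. Dom2 B a = e \<cdot> k \<longrightarrow> Cod2 B a = e \<cdot> k' \<longrightarrow>
        (\<exists>\<gamma>\<in>Cell B. Dom2 B \<gamma> = k \<and> Cod2 B \<gamma> = k' \<and> e \<lhd> \<gamma> = a))) \<and>
    (\<forall>\<gamma>\<in>Cell B. \<forall>\<delta>\<in>Cell B. Dom2 B \<gamma> = Dom2 B \<delta> \<longrightarrow> Cod B (Dom2 B \<gamma>) = Dom B e \<longrightarrow>
      e \<lhd> \<gamma> = e \<lhd> \<delta> \<longrightarrow> \<gamma> = \<delta>)"

lemma joint_equifierD:
  assumes "joint_equifier P C e"
  shows "con_arr e" "Cod B e = P" "c \<in> C \<Longrightarrow> solves e c"
    "\<lbrakk>h \<in> Mor B; Cod B h = P; \<And>c. c \<in> C \<Longrightarrow> solves h c\<rbrakk> \<Longrightarrow>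
      \<exists>k\<in>Mor B. Dom B k = Dom B h \<and> Cod B k = Dom B e \<and> e \<cdot> k = h"
    "\<lbrakk>k \<in> Mor B; k' \<in> Mor B; Dom B k = Dom B k'; Cod B k = Dom B e; Cod B k' = Dom B e;
      e \<cdot> k = e \<cdot> k'\<rbrakk> \<Longrightarrow> k = k'"
    "\<lbrakk>k \<in> Mor B; k' \<in> Mor B; Dom B k = Dom B k'; Cod B k = Dom B e; Cod B k' = Dom B e;
      a \<in> Cell B; Dom2 B a = e \<cdot> k; Cod2 B a = e \<cdot> k'\<rbrakk> \<Longrightarrow>
      \<exists>\<gamma>\<in>Cell B. Dom2 B \<gamma> = k \<and> Cod2 B \<gamma> = k' \<and> e \<lhd> \<gamma> = a"
    "\<lbrakk>\<gamma> \<in> Cell B; \<delta> \<in> Cell B; Dom2 B \<gamma> = Dom2 B \<delta>; Cod B (Dom2 B \<gamma>) = Dom B e;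
      e \<lhd> \<gamma> = e \<lhd> \<delta>\<rbrakk> \<Longrightarrow> \<gamma> = \<delta>"
  using assms unfolding joint_equifier_def by blast+

lemma joint_equifier_empty:
  assumes "con_ob P" shows "joint_equifier P {} (Ide B P)"
  unfolding joint_equifier_def
  using con_closed(1)[OF assms] PIE_ob_PIE_arr_PIE_cell.ide[OF assms] by auto

text \<open>The sides of \<open>c\<close> are restricted along \<open>e\<close>, and
  \<open>e\<close> is composed with the chosen equifier of the restricted pair. The equations in
  \<open>C\<close> survive, because a solution remains one after precomposition.\<close>

lemma joint_equifier_insert:
  assumes e: "joint_equifier P C e" and c: "equation P c" and C: "\<And>d. d \<in> C \<Longrightarrow> equation P d"
  obtains e' where "joint_equifier P (insert c C) e'"
proof -
  note eD = joint_equifierD[OF e]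
  note e_simps = con_arrD[OF eD(1)] eD(2)
  obtain \<alpha> \<beta> where c_eq: "c = (\<alpha>, \<beta>)" by (cases c)
  have ab: "\<alpha> \<in> Cell B" "\<beta> \<in> Cell B" "Dom2 B \<beta> = Dom2 B \<alpha>" "Cod2 B \<beta> = Cod2 B \<alpha>"
    "Dom B (Dom2 B \<alpha>) = P" "con_cell \<alpha>" "con_cell \<beta>"
    using c by (auto simp: c_eq equation_def parallel2_def con_cellD)
  let ?\<alpha> = "\<alpha> \<rhd> e" and ?\<beta> = "\<beta> \<rhd> e"
  let ?e = "Equ_arr K ?\<alpha> ?\<beta>"
  have par: "parallel2 B ?\<alpha> ?\<beta>" using ab e_simps by (simp add: parallel2_def)
  have con: "con_cell ?\<alpha>" "con_cell ?\<beta>" using ab eD(1,2) by (auto intro: con_rwhisk)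
  note E = choice_equifier[OF par]
  note p = is_equifierD[OF E]
  have De: "Cod B ?e = Dom B e" using p(4) ab e_simps by simp
  \<comment> \<open>For \<open>k\<close> into the domain of \<open>e\<close>, equifying the
    restricted pair means the same as \<open>e \<cdot> k\<close> solving \<open>c\<close>.\<close>
  have whisk: "?\<alpha> \<rhd> k = \<alpha> \<rhd> (e \<cdot> k)" "?\<beta> \<rhd> k = \<beta> \<rhd> (e \<cdot> k)"
    if "k \<in> Mor B" "Cod B k = Dom B e" for k
    using that ab e_simps by (simp_all add: rwhisk_Comp)
  have "joint_equifier P (insert c C) (e \<cdot> ?e)"
    unfolding joint_equifier_def
  proof (intro conjI ballI impI)
    show "con_arr (e \<cdot> ?e)"
      using PIE_ob_PIE_arr_PIE_cell.equ_pr[OF par con] eD(1) De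
      by (intro PIE_ob_PIE_arr_PIE_cell.comp) simp_all
    show "Cod B (e \<cdot> ?e) = P" using e_simps p(1-3) De by simp
    show "solves (e \<cdot> ?e) d" if "d \<in> insert c C" for d
    proof (cases "d = c")
      case True
      then show ?thesis using p whisk[OF p(2) De] by (simp add: solves_def c_eq)
    next
      case False
      then have d: "d \<in> C" using that by simp
      then have "fst d \<in> Cell B" "snd d \<in> Cell B" "Dom B (Dom2 B (fst d)) = P"
        "Dom B (Dom2 B (snd d)) = P"
        using C[of d] by (auto simp: equation_def parallel2_def)
      then show ?thesis
        using eD(3)[OF d] e_simps p(2) De by (simp add: solves_def rwhisk_Comp)
    qed
  next
    fix h assume h: "h \<in> Mor B" "Cod B h = P" "\<forall>d\<in>insert c C. solves h d"
    then obtain k where k: "k \<in> Mor B" "Dom B k = Dom B h" "Cod B k = Dom B e" "e \<cdot> k = h"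
      using eD(4)[of h] by auto
    have "?\<alpha> \<rhd> k = ?\<beta> \<rhd> k" using whisk[OF k(1,3)] h(3) k(4) by (simp add: solves_def c_eq)
    then obtain m where "m \<in> Mor B" "Dom B m = Dom B k" "Cod B m = Equ_ob K ?\<alpha> ?\<beta>" "?e \<cdot> m = k"
      using equifier_arr[OF E k(1)] k(3) De p(4) by auto
    then show "\<exists>k\<in>Mor B. Dom B k = Dom B h \<and> Cod B k = Dom B (e \<cdot> ?e) \<and> (e \<cdot> ?e) \<cdot> k = h"
      using k p(1-3) De e_simps by (intro bexI[of _ m]) (auto simp: Comp_assoc)
  next
    fix k k' assume k: "k \<in> Mor B" "k' \<in> Mor B" "Dom B k = Dom B k'"
      "Cod B k = Dom B (e \<cdot> ?e)" "Cod B k' = Dom B (e \<cdot> ?e)"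
    have k': "Cod B k = Dom B ?e" "Cod B k' = Dom B ?e" using k p(1-3) De e_simps by simp_all
    have ass: "(e \<cdot> ?e) \<cdot> k = e \<cdot> (?e \<cdot> k)" "(e \<cdot> ?e) \<cdot> k' = e \<cdot> (?e \<cdot> k')"
      using k(1-3) k' p(1-3) De e_simps by (simp_all add: Comp_assoc)
    show "k = k'" if "(e \<cdot> ?e) \<cdot> k = (e \<cdot> ?e) \<cdot> k'"
    proof -
      have "?e \<cdot> k = ?e \<cdot> k'"
        by (rule eD(5)) (use that ass k(1-3) k' p(1-3) De in simp_all)
      then show ?thesis
        by - (rule equifier_arr_unique[OF E], use k(1-3) k' p(1-3) in simp_all)
    qed
    \<comment> \<open>A 2-cell lifts in two stages, along \<open>e\<close> and then along the new
      equifier.\<close>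
    fix a assume a: "a \<in> Cell B" "Dom2 B a = (e \<cdot> ?e) \<cdot> k" "Cod2 B a = (e \<cdot> ?e) \<cdot> k'"
    have "\<exists>\<gamma>\<in>Cell B. Dom2 B \<gamma> = ?e \<cdot> k \<and> Cod2 B \<gamma> = ?e \<cdot> k' \<and> e \<lhd> \<gamma> = a"
      by (rule eD(6)) (use a ass k(1-3) k' p(1-3) De in simp_all)
    then obtain \<gamma> where \<gamma>: "\<gamma> \<in> Cell B" "Dom2 B \<gamma> = ?e \<cdot> k" "Cod2 B \<gamma> = ?e \<cdot> k'" "e \<lhd> \<gamma> = a"
      by blast
    note k'' = k'[unfolded p(3)]
    obtain \<delta> where \<delta>: "\<delta> \<in> Cell B" "Dom2 B \<delta> = k" "Cod2 B \<delta> = k'" "?e \<lhd> \<delta> = \<gamma>"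
      by (rule equifier_cell[OF E par k(1) k''(1) k(2) k''(2) k(3) \<gamma>(1-3)])
    then show "\<exists>\<gamma>\<in>Cell B. Dom2 B \<gamma> = k \<and> Cod2 B \<gamma> = k' \<and> (e \<cdot> ?e) \<lhd> \<gamma> = a"
      using \<gamma> k' p(1-3) De e_simps by (intro bexI[of _ \<delta>]) (auto simp: lwhisk_Comp)
  next
    fix \<gamma> \<delta> assume cells: "\<gamma> \<in> Cell B" "\<delta> \<in> Cell B" "Dom2 B \<gamma> = Dom2 B \<delta>"
      "Cod B (Dom2 B \<gamma>) = Dom B (e \<cdot> ?e)" "(e \<cdot> ?e) \<lhd> \<gamma> = (e \<cdot> ?e) \<lhd> \<delta>"
    have D: "Cod B (Dom2 B \<gamma>) = Dom B ?e" "Cod B (Dom2 B \<delta>) = Dom B ?e"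
      using cells p(1-3) De e_simps by simp_all
    have "?e \<lhd> \<gamma> = ?e \<lhd> \<delta>"
      by (rule eD(7)) (use cells(1-3,5) D p(1-3) De e_simps in \<open>simp_all add: lwhisk_Comp\<close>)
    then show "\<gamma> = \<delta>"
      by - (rule equifier_cell_unique[OF E], use cells(1-3) D p(1-3) in simp_all)
  qed
  then show ?thesis by (rule that)
qed

lemma ex_joint_equifier:
  assumes "finite C" "con_ob P" "\<And>c. c \<in> C \<Longrightarrow> equation P c"
  obtains e where "joint_equifier P C e"
proof -
  have "\<exists>e. joint_equifier P C e" using assms
  proof (induction rule: finite_induct)
    case empty
    then show ?case using joint_equifier_empty by blast
  next
    case (insert c C)
    then obtain e where "joint_equifier P C e" by auto
    with insert.prems show ?case by (metis joint_equifier_insert insertCI)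
  qed
  with that show ?thesis by blast
qed

end

section \<open>The limit\<close>

lemma connected_component_eq:
  assumes "f \<in> Mor C"
  shows "connected_component C (Dom C f) = connected_component C (Cod C f)"
proof -
  let ?R = "{(Y, Z). \<exists>f\<in>Mor C. Dom C f = Y \<and> Cod C f = Z}"
  have "(Dom C f, Cod C f) \<in> (?R \<union> ?R\<inverse>)\<^sup>*" "(Cod C f, Dom C f) \<in> (?R \<union> ?R\<inverse>)\<^sup>*"
    using assms by auto
  then have "(Dom C f, Y) \<in> (?R \<union> ?R\<inverse>)\<^sup>* \<longleftrightarrow> (Cod C f, Y) \<in> (?R \<union> ?R\<inverse>)\<^sup>*" for Y
    by (meson rtrancl_trans)
  then show ?thesis
    unfolding connected_component_def Let_def by (simp only:)
qed

text \<open>The equations for \<open>t\<close> compare parallel arrows of \<open>S\<close> whose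
  source is initial in their component, so they hold by uniqueness. Identities and composites of
  arrows in \<open>S\<close> are again in \<open>S\<close>, which makes both sides eligible.\<close>

lemma PIE_initial:
  assumes "PIE_indexing_pair U A S"
  obtains z t where
    "\<And>X. X \<in> Ob A \<Longrightarrow> z X \<in> Ob A"
    "\<And>X. X \<in> Ob A \<Longrightarrow> t X \<in> S \<and> Dom A (t X) = z X \<and> Cod A (t X) = X"
    "\<And>f. f \<in> S \<Longrightarrow> z (Dom A f) = z (Cod A f) \<and> f \<cdot>\<^bsub>A\<^esub> t (Dom A f) = t (Cod A f)"
    "\<And>X. X \<in> Ob A \<Longrightarrow> t (z X) = Ide A (z X)"
proof -
  from assms have ip: "S \<subseteq> Mor A" "\<And>X. X \<in> Ob A \<Longrightarrow> Ide A X \<in> S"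
    "\<And>f g. \<lbrakk>f \<in> S; g \<in> S; Dom A g = Cod A f\<rbrakk> \<Longrightarrow> g \<cdot>\<^bsub>A\<^esub> f \<in> S" "two_category A"
    by (auto simp: PIE_indexing_pair_def indexing_pair_def small_two_category_def)
  interpret A: two_category A by (rule ip(4))
  define comp where "comp = connected_component (wide_subcat A S)"
  have comp_eq: "comp (Dom A f) = comp (Cod A f)" if "f \<in> S" for f
    using connected_component_eq[of f "wide_subcat A S"] that
    by (simp add: comp_def wide_subcat_def)
  have comp_self: "X \<in> comp X" and comp_Ob: "comp X \<subseteq> Ob A" if "X \<in> Ob A" for X
    using that by (auto simp: comp_def connected_component_def wide_subcat_def Let_def)
  let ?W = "\<lambda>X. full_subcat (wide_subcat A S) (comp X)"
  have init: "initial_object (?W X) Z \<longleftrightarrow> Z \<in> comp X \<and>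
      (\<forall>Y\<in>comp X. \<exists>!f. f \<in> S \<and> Dom A f = Z \<and> Cod A f = Y)" if "X \<in> Ob A" for X Z
  proof -
    have "Ob (?W X) = comp X"
      using comp_Ob[OF that] by (auto simp: full_subcat_def wide_subcat_def)
    moreover have "f \<in> Mor (?W X) \<and> Dom (?W X) f = Z \<and> Cod (?W X) f = Y \<longleftrightarrow>
        f \<in> S \<and> Dom A f = Z \<and> Cod A f = Y" if "Z \<in> comp X" "Y \<in> comp X" for f Y
      using that by (auto simp: full_subcat_def wide_subcat_def)
    ultimately show ?thesis unfolding initial_object_def by (simp cong: conj_cong)
  qed
  \<comment> \<open>\<open>?W X\<close> depends on \<open>X\<close> only through its component, so
    the same initial object is chosen throughout a component. Hence \<open>z_eq\<close> and
    \<open>zz\<close> are equalities of objects, not mere isomorphisms.\<close>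
  define z where "z X = (SOME Z. initial_object (?W X) Z)" for X
  have z: "initial_object (?W X) (z X)" if "X \<in> Ob A" for X
    unfolding z_def by (rule someI_ex)
      (use assms that in \<open>auto simp: PIE_indexing_pair_def comp_def\<close>)
  have z_eq: "z (Dom A f) = z (Cod A f)" if "f \<in> S" for f
    using comp_eq[OF that] by (simp add: z_def)
  define t where "t X = (THE f. f \<in> S \<and> Dom A f = z X \<and> Cod A f = X)" for X
  have ex1: "\<exists>!f. f \<in> S \<and> Dom A f = z X \<and> Cod A f = X" if "X \<in> Ob A" for X
    using z[OF that] init[OF that] comp_self[OF that] by blast
  have t: "t X \<in> S \<and> Dom A (t X) = z X \<and> Cod A (t X) = X" if "X \<in> Ob A" for X
    unfolding t_def by (rule theI'[OF ex1[OF that]])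
  have t_unique: "f = t X" if "X \<in> Ob A" "f \<in> S" "Dom A f = z X" "Cod A f = X" for f X
    using ex1[OF that(1)] t[OF that(1)] that by blast
  have z_Ob: "z X \<in> Ob A" if "X \<in> Ob A" for X
    using z[OF that] init[OF that] comp_Ob[OF that] by blast
  have zz: "z (z X) = z X" if "X \<in> Ob A" for X
    using z_eq[of "t X"] t[OF that] by simp
  show ?thesis
  proof (rule that[of z t])
    show "z (Dom A f) = z (Cod A f) \<and> f \<cdot>\<^bsub>A\<^esub> t (Dom A f) = t (Cod A f)" if f: "f \<in> S" for f
    proof
      show "z (Dom A f) = z (Cod A f)" by (rule z_eq[OF f])
      have "f \<in> Mor A" using f ip(1) by auto
      then have D: "t (Dom A f) \<in> S" "Dom A (t (Dom A f)) = z (Dom A f)" "Cod A (t (Dom A f)) = Dom A f"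
        using t[of "Dom A f"] by auto
      then have "t (Dom A f) \<in> Mor A" using ip(1) by auto
      then show "f \<cdot>\<^bsub>A\<^esub> t (Dom A f) = t (Cod A f)"
        using D f \<open>f \<in> Mor A\<close> z_eq[OF f] ip(3) by (intro t_unique) auto
    qed
    show "t (z X) = Ide A (z X)" if "X \<in> Ob A" for X
      using that z_Ob[OF that] zz[OF that] ip(2) by (intro t_unique[symmetric]) auto
  qed (use t z_Ob in auto)
qed

text \<open>The universal family of legs compatible with the initial arrows \<open>t X : z X \<rightarrow> X\<close>, together
  with 2-cells \<open>\<tau> f\<close> that are not yet subject to any cone equation.\<close>

locale generic_precone = pie_setting B A F U K
  for B :: "('ob, 'ab, 'cb) twocat" (structure) and A :: "('oa, 'aa, 'ca) twocat"
    and F :: "('oa, 'aa, 'ca, 'ob, 'ab, 'cb) twofun"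
    and U :: "'i set" and K :: "('i, 'ob, 'ab, 'cb) PIE_ops" +
  fixes z :: "'oa \<Rightarrow> 'oa" and t :: "'oa \<Rightarrow> 'aa" and N :: 'ob and l :: "'oa \<Rightarrow> 'ab" and \<tau> :: "'aa \<Rightarrow> 'cb"
  assumes con_N: "con_ob N"
    and l: "X \<in> Ob A \<Longrightarrow> con_arr (l X) \<and> Dom B (l X) = N \<and> Cod B (l X) = Fun0 F X"
    and l_t: "X \<in> Ob A \<Longrightarrow> l X = Fun1 F (t X) \<cdot> l (z X)"
    and \<tau>: "f \<in> Mor A \<Longrightarrow> con_cell (\<tau> f) \<and> Dom2 B (\<tau> f) = Fun1 F f \<cdot> l (Dom A f) \<and>
      Cod2 B (\<tau> f) = l (Cod A f)"
    and precone_arr: "\<lbrakk>E \<in> Ob B;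
        \<And>X. X \<in> Ob A \<Longrightarrow> x X \<in> Mor B \<and> Dom B (x X) = E \<and> Cod B (x X) = Fun0 F X;
        \<And>X. X \<in> Ob A \<Longrightarrow> x X = Fun1 F (t X) \<cdot> x (z X);
        \<And>f. f \<in> Mor A \<Longrightarrow> \<mu> f \<in> Cell B \<and> Dom2 B (\<mu> f) = Fun1 F f \<cdot> x (Dom A f) \<and>
          Cod2 B (\<mu> f) = x (Cod A f)\<rbrakk>
      \<Longrightarrow> \<exists>k\<in>Mor B. Dom B k = E \<and> Cod B k = N \<and> (\<forall>X\<in>Ob A. l X \<cdot> k = x X) \<and>
        (\<forall>f\<in>Mor A. \<tau> f \<rhd> k = \<mu> f)"
    and arr_unique: "\<lbrakk>k \<in> Mor B; k' \<in> Mor B; Dom B k = Dom B k'; Cod B k = N; Cod B k' = N;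
        \<And>X. X \<in> Ob A \<Longrightarrow> l X \<cdot> k = l X \<cdot> k'; \<And>f. f \<in> Mor A \<Longrightarrow> \<tau> f \<rhd> k = \<tau> f \<rhd> k'\<rbrakk> \<Longrightarrow> k = k'"
    and precone_cell: "\<lbrakk>k \<in> Mor B; k' \<in> Mor B; Dom B k = Dom B k'; Cod B k = N; Cod B k' = N;
        \<And>X. X \<in> Ob A \<Longrightarrow> a X \<in> Cell B \<and> Dom2 B (a X) = l X \<cdot> k \<and> Cod2 B (a X) = l X \<cdot> k';
        \<And>X. X \<in> Ob A \<Longrightarrow> a X = Fun1 F (t X) \<lhd> a (z X);
        \<And>f. f \<in> Mor A \<Longrightarrow> (\<tau> f \<rhd> k') \<bullet> (Fun1 F f \<lhd> a (Dom A f)) = a (Cod A f) \<bullet> (\<tau> f \<rhd> k)\<rbrakk>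
      \<Longrightarrow> \<exists>\<alpha>\<in>Cell B. Dom2 B \<alpha> = k \<and> Cod2 B \<alpha> = k' \<and> (\<forall>X\<in>Ob A. l X \<lhd> \<alpha> = a X)"
    and cell_unique: "\<lbrakk>\<alpha> \<in> Cell B; \<beta> \<in> Cell B; Dom2 B \<alpha> = Dom2 B \<beta>; Cod2 B \<alpha> = Cod2 B \<beta>;
        Cod B (Dom2 B \<alpha>) = N; \<And>X. X \<in> Ob A \<Longrightarrow> l X \<lhd> \<alpha> = l X \<lhd> \<beta>\<rbrakk> \<Longrightarrow> \<alpha> = \<beta>"

text \<open>An arrow into the inserter of \<open>u\<close> and \<open>v\<close> is an arrow
  \<open>h\<close> into \<open>P\<close> together with a single 2-cell from
  \<open>u \<cdot> h\<close> to \<open>v \<cdot> h\<close>. The projections \<open>q f\<close> split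
  this 2-cell into independent components, one for each arrow of \<open>A\<close>, and these are the
  \<open>\<tau> f\<close>.\<close>

lemma (in pie_setting) ex_generic_precone:
  assumes size: "Ob A \<lesssim> U" "Mor A \<lesssim> U" and S: "S \<subseteq> Mor A"
    and z: "\<And>X. X \<in> Ob A \<Longrightarrow> z X \<in> Ob A"
    and t: "\<And>X. X \<in> Ob A \<Longrightarrow> t X \<in> S \<and> Dom A (t X) = z X \<and> Cod A (t X) = X"
    and zt: "\<And>f. f \<in> S \<Longrightarrow> z (Dom A f) = z (Cod A f) \<and> f \<cdot>\<^bsub>A\<^esub> t (Dom A f) = t (Cod A f)"
    and tz: "\<And>X. X \<in> Ob A \<Longrightarrow> t (z X) = Ide A (z X)"
  obtains N l \<tau> where "generic_precone B A F U K z t N l \<tau>"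
proof -
  have tM: "t X \<in> Mor A" "Dom A (t X) = z X" "Cod A (t X) = X" if "X \<in> Ob A" for X
    using t[OF that] S by auto
  have zz: "z (z X) = z X" if "X \<in> Ob A" for X
    using zt[of "t X"] t[OF that] by simp
  let ?I = "z ` Ob A"
  have I: "?I \<lesssim> U" using z size(1) by (meson image_subsetI lepoll_trans subset_imp_lepoll)
  have "con_ob (Fun0 F Z)" if "Z \<in> ?I" for Z
    using that z by (auto intro: PIE_ob_PIE_arr_PIE_cell.diag_ob)
  then obtain P p where P: "con_product ?I (Fun0 F) P p" by (rule ex_con_product[OF I])
  note p0 = con_product_simps[OF P]
  have p: "con_arr (p (z X))" "p (z X) \<in> Mor B" "Dom B (p (z X)) = P" "Cod B (p (z X)) = Fun0 F (z X)"
    if "X \<in> Ob A" for X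
    using p0 that by simp_all
  have PB: "P \<in> Ob B" by (rule con_closed(1)[OF p0(1)])
  have "con_ob (Fun0 F (Cod A f))" if "f \<in> Mor A" for f
    using that by (auto intro: PIE_ob_PIE_arr_PIE_cell.diag_ob)
  then obtain R q where R: "con_product (Mor A) (\<lambda>f. Fun0 F (Cod A f)) R q"
    by (rule ex_con_product[OF size(2)])
  note q = con_product_simps[OF R]
  \<comment> \<open>The leg at \<open>X\<close> that the projection at \<open>z X\<close> forces
    through \<open>t X\<close>.\<close>
  define m where "m X = Fun1 F (t X) \<cdot> p (z X)" for X
  have m: "m X \<in> Mor B" "Dom B (m X) = P" "Cod B (m X) = Fun0 F X" "con_arr (m X)"
    if "X \<in> Ob A" for X
    using that tM[OF that] p z
    by (simp_all add: m_def PIE_ob_PIE_arr_PIE_cell.comp PIE_ob_PIE_arr_PIE_cell.diag_arr)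
  \<comment> \<open>\<open>z X\<close> is the initial object of its own component and
    \<open>t (z X)\<close> is an identity, so the forced leg there is the bare projection.\<close>
  have mz: "m (z X) = p (z X)" if "X \<in> Ob A" for X
    using that z[OF that] p[OF that] by (simp add: m_def tz zz)
  \<comment> \<open>The arrows \<open>u\<close> and \<open>v\<close> are the tuples of the sources
    and of the targets required of the 2-cells at the arrows \<open>f\<close>.\<close>
  have "con_arr (Fun1 F f \<cdot> m (Dom A f))" if "f \<in> Mor A" for f
    using that m[of "Dom A f"]
    by (intro PIE_ob_PIE_arr_PIE_cell.comp PIE_ob_PIE_arr_PIE_cell.diag_arr) simp_all
  then obtain u where u: "u \<in> Mor B" "Dom B u = P" "Cod B u = R"
    "\<And>f. f \<in> Mor A \<Longrightarrow> q f \<cdot> u = Fun1 F f \<cdot> m (Dom A f)" "con_arr u"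
    by - (rule con_product_arr[OF R PB, of "\<lambda>f. Fun1 F f \<cdot> m (Dom A f)"],
      use m p0(1) in auto)
  obtain v where v: "v \<in> Mor B" "Dom B v = P" "Cod B v = R"
    "\<And>f. f \<in> Mor A \<Longrightarrow> q f \<cdot> v = m (Cod A f)" "con_arr v"
    by (rule con_product_arr[OF R PB, of "\<lambda>f. m (Cod A f)"]) (use m p0(1) in auto)
  have par: "parallel B u v" using u v by (simp add: parallel_def)
  define N where "N = Ins_ob K u v"
  define n where "n = Ins_arr K u v"
  define \<kappa> where "\<kappa> = Ins_cell K u v"
  have N: "is_inserter B u v N n \<kappa>"
    using choice_inserter[OF par] by (simp add: N_def n_def \<kappa>_def)
  note n = is_inserterD[OF N]
  have n_con: "con_ob N" "con_arr n" "con_cell \<kappa>"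
    using par u(5) v(5) by (auto simp: N_def n_def \<kappa>_def
      intro: PIE_ob_PIE_arr_PIE_cell.ins_ob PIE_ob_PIE_arr_PIE_cell.ins_pr PIE_ob_PIE_arr_PIE_cell.ins_pr2)
  have n_simps: "n \<in> Mor B" "Dom B n = N" "Cod B n = P" using n u by simp_all
  have la: "\<kappa> \<in> Cell B" "Dom2 B \<kappa> = u \<cdot> n" "Cod2 B \<kappa> = v \<cdot> n" using n by simp_all
  define l where "l X = m X \<cdot> n" for X
  define \<tau> where "\<tau> f = q f \<lhd> \<kappa>" for f
  have l: "l X \<in> Mor B" "Dom B (l X) = N" "Cod B (l X) = Fun0 F X" "con_arr (l X)"
    if "X \<in> Ob A" for X
    using m[OF that] n_simps n_con(2) by (simp_all add: l_def PIE_ob_PIE_arr_PIE_cell.comp)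
  have lk: "l X \<cdot> k = m X \<cdot> (n \<cdot> k)" if "X \<in> Ob A" "k \<in> Mor B" "Cod B k = N" for X k
    using that m n_simps by (simp add: l_def Comp_assoc)
  have lw_l: "l X \<lhd> \<alpha> = m X \<lhd> (n \<lhd> \<alpha>)" if "X \<in> Ob A" "\<alpha> \<in> Cell B" "Cod B (Dom2 B \<alpha>) = N" for X \<alpha>
    using that m n_simps by (simp add: l_def lwhisk_Comp)
  have tau_k: "\<tau> f \<rhd> k = q f \<lhd> (\<kappa> \<rhd> k)" if "f \<in> Mor A" "k \<in> Mor B" "Cod B k = N" for f k
    using that q la n_simps u by (simp add: \<tau>_def lwhisk_rwhisk)
  have qu: "q f \<cdot> (u \<cdot> h) = Fun1 F f \<cdot> (m (Dom A f) \<cdot> h)" and qv: "q f \<cdot> (v \<cdot> h) = m (Cod A f) \<cdot> h"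
    if "f \<in> Mor A" "h \<in> Mor B" "Cod B h = P" for f h
    using that q u v m by (simp_all flip: Comp_assoc)
  show ?thesis
  proof (rule that[of N l \<tau>], unfold_locales)
    show "con_ob N" by (rule n_con)
  next
    fix X assume X: "X \<in> Ob A"
    show "con_arr (l X) \<and> Dom B (l X) = N \<and> Cod B (l X) = Fun0 F X" using l[OF X] by simp
    show "l X = Fun1 F (t X) \<cdot> l (z X)"
      using X z[OF X] tM[OF X] p n_simps by (simp add: l_def mz) (simp add: m_def Comp_assoc)
  next
    fix f assume f: "f \<in> Mor A"
    show "con_cell (\<tau> f) \<and> Dom2 B (\<tau> f) = Fun1 F f \<cdot> l (Dom A f) \<and> Cod2 B (\<tau> f) = l (Cod A f)"
      using f q la n_simps n_con u qu qv by (simp add: \<tau>_def con_lwhisk l_def)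
  next
    fix E x \<mu>
    assume E: "E \<in> Ob B"
      and x: "\<And>X. X \<in> Ob A \<Longrightarrow> x X \<in> Mor B \<and> Dom B (x X) = E \<and> Cod B (x X) = Fun0 F X"
      and xt: "\<And>X. X \<in> Ob A \<Longrightarrow> x X = Fun1 F (t X) \<cdot> x (z X)"
      and \<mu>: "\<And>f. f \<in> Mor A \<Longrightarrow> \<mu> f \<in> Cell B \<and> Dom2 B (\<mu> f) = Fun1 F f \<cdot> x (Dom A f) \<and>
          Cod2 B (\<mu> f) = x (Cod A f)"
    obtain h where h: "h \<in> Mor B" "Dom B h = E" "Cod B h = P" "\<And>Z. Z \<in> ?I \<Longrightarrow> p Z \<cdot> h = x Z"
      by (rule con_product_arr[OF P E, of x]) (use x z in auto)
    \<comment> \<open>The product prescribes \<open>h\<close> at the initial objects only. The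
      compatibility \<open>xt\<close> extends the agreement to all legs.\<close>
    have mh: "m X \<cdot> h = x X" if "X \<in> Ob A" for X
      using that h tM[OF that] p[OF that] xt[OF that] by (simp add: m_def Comp_assoc)
    obtain \<mu>' where \<mu>': "\<mu>' \<in> Cell B" "Dom2 B \<mu>' = u \<cdot> h" "Cod2 B \<mu>' = v \<cdot> h"
      "\<And>f. f \<in> Mor A \<Longrightarrow> q f \<lhd> \<mu>' = \<mu> f"
      by (rule con_product_cell[OF R, of "u \<cdot> h" "v \<cdot> h" \<mu>]) (use u v h \<mu> qu qv mh in auto)
    obtain k where k: "k \<in> Mor B" "Dom B k = E" "Cod B k = N" "n \<cdot> k = h" "\<kappa> \<rhd> k = \<mu>'"
      using inserter_arr[OF N h(1) _ \<mu>'(1-3)] h u by auto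
    then show "\<exists>k\<in>Mor B. Dom B k = E \<and> Cod B k = N \<and> (\<forall>X\<in>Ob A. l X \<cdot> k = x X) \<and>
        (\<forall>f\<in>Mor A. \<tau> f \<rhd> k = \<mu> f)"
      using lk tau_k mh \<mu>'(4) by (intro bexI[of _ k]) auto
  next
    fix k k'
    assume k: "k \<in> Mor B" "k' \<in> Mor B" "Dom B k = Dom B k'" "Cod B k = N" "Cod B k' = N"
      and lkk: "\<And>X. X \<in> Ob A \<Longrightarrow> l X \<cdot> k = l X \<cdot> k'"
      and tkk: "\<And>f. f \<in> Mor A \<Longrightarrow> \<tau> f \<rhd> k = \<tau> f \<rhd> k'"
    \<comment> \<open>The projection \<open>p (z X)\<close> after \<open>n\<close> is the leg
      \<open>l (z X)\<close>, so the hypothesis on legs controls the arrows into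
      \<open>P\<close>.\<close>
    have "p Z \<cdot> (n \<cdot> k) = p Z \<cdot> (n \<cdot> k')" if "Z \<in> ?I" for Z
    proof -
      from that obtain X where X: "X \<in> Ob A" "Z = z X" by auto
      then show ?thesis using lkk[OF z[OF X(1)]] lk[OF z[OF X(1)]] k mz by simp
    qed
    then have nk: "n \<cdot> k = n \<cdot> k'"
      by - (rule con_product_arr_unique[OF P], use k n_simps in simp_all)
    have "\<kappa> \<rhd> k = \<kappa> \<rhd> k'"
    proof (rule con_product_cell_unique[OF R])
      show "q f \<lhd> (\<kappa> \<rhd> k) = q f \<lhd> (\<kappa> \<rhd> k')" if "f \<in> Mor A" for f
        using tkk[OF that] tau_k[OF that] k by simp
    qed (use k la n_simps u v nk in \<open>simp_all add: Comp_assoc\<close>)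
    then show "k = k'" by - (rule inserter_arr_unique[OF N], use k nk in simp_all)
  next
    fix k k' a
    assume k: "k \<in> Mor B" "k' \<in> Mor B" "Dom B k = Dom B k'" "Cod B k = N" "Cod B k' = N"
      and a: "\<And>X. X \<in> Ob A \<Longrightarrow> a X \<in> Cell B \<and> Dom2 B (a X) = l X \<cdot> k \<and> Cod2 B (a X) = l X \<cdot> k'"
      and at: "\<And>X. X \<in> Ob A \<Longrightarrow> a X = Fun1 F (t X) \<lhd> a (z X)"
      and nat: "\<And>f. f \<in> Mor A \<Longrightarrow>
        (\<tau> f \<rhd> k') \<bullet> (Fun1 F f \<lhd> a (Dom A f)) = a (Cod A f) \<bullet> (\<tau> f \<rhd> k)"
    have "a Z \<in> Cell B \<and> Dom2 B (a Z) = p Z \<cdot> (n \<cdot> k) \<and> Cod2 B (a Z) = p Z \<cdot> (n \<cdot> k')" if "Z \<in> ?I" for Z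
    proof -
      from that obtain X where X: "X \<in> Ob A" "Z = z X" by auto
      then show ?thesis using a[OF z[OF X(1)]] lk[OF z[OF X(1)]] k mz by simp
    qed
    with con_product_cell[OF P, of "n \<cdot> k" "n \<cdot> k'" a] k n_simps
    obtain \<alpha> where \<alpha>: "\<alpha> \<in> Cell B" "Dom2 B \<alpha> = n \<cdot> k" "Cod2 B \<alpha> = n \<cdot> k'" "\<And>Z. Z \<in> ?I \<Longrightarrow> p Z \<lhd> \<alpha> = a Z"
      by (metis (no_types, lifting) Cod_Comp Comp_Mor Dom_Comp)
    have C\<alpha>: "Cod B (Dom2 B \<alpha>) = P" using \<alpha> k n_simps by simp
    have m\<alpha>: "m X \<lhd> \<alpha> = a X" if "X \<in> Ob A" for X
      using that tM[OF that] p[OF that] \<alpha> C\<alpha> at[OF that] by (simp add: m_def lwhisk_Comp)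
    \<comment> \<open>This is the condition for lifting \<open>\<alpha>\<close> along the inserter.
      After projection by \<open>q f\<close> it becomes the naturality square \<open>nat\<close> at
      \<open>f\<close>.\<close>
    have "(\<kappa> \<rhd> k') \<bullet> (u \<lhd> \<alpha>) = (v \<lhd> \<alpha>) \<bullet> (\<kappa> \<rhd> k)"
    proof (rule con_product_cell_unique[OF R])
      fix f assume f: "f \<in> Mor A"
      have "q f \<lhd> (u \<lhd> \<alpha>) = Fun1 F f \<lhd> a (Dom A f)"
      proof -
        have "q f \<lhd> (u \<lhd> \<alpha>) = (q f \<cdot> u) \<lhd> \<alpha>"
          by (rule lwhisk_Comp[symmetric]) (use f q u(1-3) \<alpha> C\<alpha> in simp_all)
        also have "\<dots> = Fun1 F f \<lhd> (m (Dom A f) \<lhd> \<alpha>)" using f u m \<alpha> C\<alpha> by (simp add: lwhisk_Comp)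
        finally show ?thesis using m\<alpha> f by simp
      qed
      moreover have "q f \<lhd> (v \<lhd> \<alpha>) = a (Cod A f)"
      proof -
        have "q f \<lhd> (v \<lhd> \<alpha>) = (q f \<cdot> v) \<lhd> \<alpha>"
          by (rule lwhisk_Comp[symmetric]) (use f q v(1-3) \<alpha> C\<alpha> in simp_all)
        then show ?thesis using m\<alpha> f v by simp
      qed
      moreover have "q f \<lhd> ((\<kappa> \<rhd> k') \<bullet> (u \<lhd> \<alpha>)) = (q f \<lhd> (\<kappa> \<rhd> k')) \<bullet> (q f \<lhd> (u \<lhd> \<alpha>))"
        "q f \<lhd> ((v \<lhd> \<alpha>) \<bullet> (\<kappa> \<rhd> k)) = (q f \<lhd> (v \<lhd> \<alpha>)) \<bullet> (q f \<lhd> (\<kappa> \<rhd> k))"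
        using f q u v k la n_simps \<alpha> C\<alpha> by (simp_all add: lwhisk_Comp2 Comp_assoc)
      ultimately show "q f \<lhd> ((\<kappa> \<rhd> k') \<bullet> (u \<lhd> \<alpha>)) = q f \<lhd> ((v \<lhd> \<alpha>) \<bullet> (\<kappa> \<rhd> k))"
        using nat[OF f] tau_k[OF f] k by simp
    qed (use k la n_simps u v \<alpha> C\<alpha> in \<open>simp_all add: Comp_assoc\<close>)
    from inserter_cell[OF N par k(1,4,2,5,3) \<alpha>(1-3) this]
    obtain \<beta> where \<beta>: "\<beta> \<in> Cell B" "Dom2 B \<beta> = k" "Cod2 B \<beta> = k'" "n \<lhd> \<beta> = \<alpha>" .
    then show "\<exists>\<alpha>\<in>Cell B. Dom2 B \<alpha> = k \<and> Cod2 B \<alpha> = k' \<and> (\<forall>X\<in>Ob A. l X \<lhd> \<alpha> = a X)"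
      using lw_l m\<alpha> k by (intro bexI[of _ \<beta>]) auto
  next
    fix \<alpha> \<beta>
    assume ab: "\<alpha> \<in> Cell B" "\<beta> \<in> Cell B" "Dom2 B \<alpha> = Dom2 B \<beta>" "Cod2 B \<alpha> = Cod2 B \<beta>"
        "Cod B (Dom2 B \<alpha>) = N" and lab: "\<And>X. X \<in> Ob A \<Longrightarrow> l X \<lhd> \<alpha> = l X \<lhd> \<beta>"
    have "n \<lhd> \<alpha> = n \<lhd> \<beta>"
    proof (rule con_product_cell_unique[OF P])
      fix Z assume "Z \<in> ?I"
      then obtain X where X: "X \<in> Ob A" "Z = z X" by auto
      then show "p Z \<lhd> (n \<lhd> \<alpha>) = p Z \<lhd> (n \<lhd> \<beta>)"
        using lab[OF z[OF X(1)]] lw_l[OF z[OF X(1)]] ab mz by simp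
    qed (use ab n_simps in simp_all)
    then show "\<alpha> = \<beta>" by - (rule inserter_cell_unique[OF N], use ab in simp_all)
  qed
qed

section \<open>Cone conditions as equations on the generic precone, and the limit\<close>

context generic_precone
begin

lemma l_simps [simp]:
  assumes "X \<in> Ob A"
  shows "l X \<in> Mor B" "Dom B (l X) = N" "Cod B (l X) = Fun0 F X" "con_arr (l X)"
  using l[OF assms] con_arrD(1) by auto

lemma \<tau>_simps [simp]:
  assumes "f \<in> Mor A"
  shows "\<tau> f \<in> Cell B" "Dom2 B (\<tau> f) = Fun1 F f \<cdot> l (Dom A f)" "Cod2 B (\<tau> f) = l (Cod A f)"
    "con_cell (\<tau> f)"
  using \<tau>[OF assms] con_cellD(1) by auto

definition precone :: "'ab \<Rightarrow> ('oa, 'aa, 'ab, 'cb) cone" where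
  "precone k = \<lparr>leg = \<lambda>X\<in>Ob A. l X \<cdot> k, tri = \<lambda>f\<in>Mor A. \<tau> f \<rhd> k\<rparr>"

definition id_eq :: "'aa \<Rightarrow> 'cb \<times> 'cb" where
  "id_eq f = (\<tau> f, Ide2 B (l (Cod A f)))"

definition comp_eq :: "'aa \<Rightarrow> 'aa \<Rightarrow> 'cb \<times> 'cb" where
  "comp_eq f g = (\<tau> (g \<cdot>\<^bsub>A\<^esub> f), \<tau> g \<bullet> (Fun1 F g \<lhd> \<tau> f))"

definition nat_eq :: "'ca \<Rightarrow> 'cb \<times> 'cb" where
  "nat_eq \<gamma> = (\<tau> (Dom2 A \<gamma>), \<tau> (Cod2 A \<gamma>) \<bullet> (Fun2 F \<gamma> \<rhd> l (Dom A (Dom2 A \<gamma>))))"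

text \<open>The second hypothesis is what makes \<open>\<tau> f\<close> parallel to an identity
  2-cell. It is an equation between arrows, later supplied by initiality for
  \<open>f \<in> S\<close>.\<close>

lemma equation_id_eq:
  assumes "f \<in> Mor A" "Fun1 F f \<cdot> l (Dom A f) = l (Cod A f)"
  shows "equation N (id_eq f)"
  using assms by (simp add: equation_def id_eq_def parallel2_def PIE_ob_PIE_arr_PIE_cell.ide2)

lemma equation_comp_eq:
  assumes "f \<in> Mor A" "g \<in> Mor A" "Dom A g = Cod A f"
  shows "equation N (comp_eq f g)"
  using assms by (simp add: equation_def comp_eq_def parallel2_def Fun1_Comp Comp_assoc
    PIE_ob_PIE_arr_PIE_cell.comp2 con_lwhisk PIE_ob_PIE_arr_PIE_cell.diag_arr)

lemma equation_nat_eq: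
  assumes "\<gamma> \<in> Cell A"
  shows "equation N (nat_eq \<gamma>)"
  using assms by (simp add: equation_def nat_eq_def parallel2_def
    PIE_ob_PIE_arr_PIE_cell.comp2 con_rwhisk PIE_ob_PIE_arr_PIE_cell.diag_cell)

lemma solves_id_eq:
  "\<lbrakk>f \<in> Mor A; k \<in> Mor B; Cod B k = N\<rbrakk> \<Longrightarrow>
    solves k (id_eq f) \<longleftrightarrow> \<tau> f \<rhd> k = Ide2 B (l (Cod A f) \<cdot> k)"
  by (simp add: solves_def id_eq_def rwhisk_Ide2)

lemma solves_comp_eq:
  "\<lbrakk>f \<in> Mor A; g \<in> Mor A; Dom A g = Cod A f; k \<in> Mor B; Cod B k = N\<rbrakk> \<Longrightarrow>
    solves k (comp_eq f g) \<longleftrightarrow> \<tau> (g \<cdot>\<^bsub>A\<^esub> f) \<rhd> k = (\<tau> g \<rhd> k) \<bullet> (Fun1 F g \<lhd> (\<tau> f \<rhd> k))"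
  by (simp add: solves_def comp_eq_def rwhisk_Comp2 lwhisk_rwhisk)

lemma solves_nat_eq:
  "\<lbrakk>\<gamma> \<in> Cell A; k \<in> Mor B; Cod B k = N\<rbrakk> \<Longrightarrow> solves k (nat_eq \<gamma>) \<longleftrightarrow>
    \<tau> (Dom2 A \<gamma>) \<rhd> k = (\<tau> (Cod2 A \<gamma>) \<rhd> k) \<bullet> (Fun2 F \<gamma> \<rhd> (l (Dom A (Dom2 A \<gamma>)) \<cdot> k))"
  by (simp add: solves_def nat_eq_def rwhisk_Comp2 rwhisk_Comp)

text \<open>The unit law of a lax cone is covered by the first clause, as identities will lie in
  \<open>S\<close>. Composable pairs are quantified arrow by arrow, in the shape in which their
  equations can be merged.\<close>

definition solves_sigma :: "'aa set \<Rightarrow> 'ab \<Rightarrow> bool" where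
  "solves_sigma S k \<longleftrightarrow> (\<forall>f\<in>S. solves k (id_eq f)) \<and>
    (\<forall>f\<in>Mor A. \<forall>g\<in>{g \<in> Mor A. Dom A g = Cod A f}. solves k (comp_eq f g)) \<and>
    (\<forall>\<gamma>\<in>Cell A. solves k (nat_eq \<gamma>))"

text \<open>The ends of the legs and triangles are already right on \<open>N\<close>. What remains
  of the cone conditions are equations between 2-cells, and whiskering them with \<open>k\<close>
  turns each into a clause of \<open>solves_sigma\<close>.\<close>

lemma precone_sigma_iff:
  assumes S: "S \<subseteq> Mor A" "\<And>X. X \<in> Ob A \<Longrightarrow> Ide A X \<in> S" and k: "k \<in> Mor B" "Cod B k = N"
  shows "precone k \<in> Ob (sigma_s_cone_cat A S B F (Dom B k)) \<longleftrightarrow> solves_sigma S k"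
proof
  assume cone: "precone k \<in> Ob (sigma_s_cone_cat A S B F (Dom B k))"
  then have lax: "lax_cone A B F (Dom B k) (precone k)" by (simp add: sigma_cone_simps)
  show "solves_sigma S k"
    unfolding solves_sigma_def
  proof (intro conjI ballI)
    show "solves k (id_eq f)" if "f \<in> S" for f
    proof -
      have f: "f \<in> Mor A" using that S by auto
      show ?thesis using sigma_cone_tri(1)[OF cone that f] k f by (simp add: solves_id_eq precone_def)
    qed
    show "solves k (comp_eq f g)" if "f \<in> Mor A" "g \<in> {g \<in> Mor A. Dom A g = Cod A f}" for f g
      using lax_coneD(8)[OF lax, of f g] that k by (simp add: solves_comp_eq precone_def)
    show "solves k (nat_eq \<gamma>)" if "\<gamma> \<in> Cell A" for \<gamma>
      using lax_coneD(9)[OF lax that] that k by (simp add: solves_nat_eq precone_def)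
  qed
next
  assume "solves_sigma S k"
  then have eqs: "\<And>f. f \<in> S \<Longrightarrow> \<tau> f \<rhd> k = Ide2 B (l (Cod A f) \<cdot> k)"
    "\<And>f g. \<lbrakk>f \<in> Mor A; g \<in> Mor A; Dom A g = Cod A f\<rbrakk> \<Longrightarrow>
      \<tau> (g \<cdot>\<^bsub>A\<^esub> f) \<rhd> k = (\<tau> g \<rhd> k) \<bullet> (Fun1 F g \<lhd> (\<tau> f \<rhd> k))"
    "\<And>\<gamma>. \<gamma> \<in> Cell A \<Longrightarrow> \<tau> (Dom2 A \<gamma>) \<rhd> k =
      (\<tau> (Cod2 A \<gamma>) \<rhd> k) \<bullet> (Fun2 F \<gamma> \<rhd> (l (Dom A (Dom2 A \<gamma>)) \<cdot> k))"
    using S k by (auto simp: solves_sigma_def solves_id_eq solves_comp_eq solves_nat_eq subset_iff)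
  have "tri (precone k) f \<in> Ide2 B ` Mor B" if "f \<in> S" for f
  proof -
    have f: "f \<in> Mor A" using S that by auto
    then show ?thesis using eqs(1)[OF that] k by (simp add: precone_def)
  qed
  moreover have "lax_cone A B F (Dom B k) (precone k)"
    using k by (simp add: lax_cone_def precone_def PiE_iff Comp_assoc eqs(2,3) eqs(1)[OF S(2)])
  ultimately show "precone k \<in> Ob (sigma_s_cone_cat A S B F (Dom B k))"
    by (simp add: sigma_cone_simps)
qed

lemma precone_eqD:
  assumes "precone k = precone k'"
  shows "X \<in> Ob A \<Longrightarrow> l X \<cdot> k = l X \<cdot> k'" "f \<in> Mor A \<Longrightarrow> \<tau> f \<rhd> k = \<tau> f \<rhd> k'"
proof -
  have "leg (precone k) X = leg (precone k') X" "tri (precone k) f = tri (precone k') f"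
    using assms by simp_all
  then show "X \<in> Ob A \<Longrightarrow> l X \<cdot> k = l X \<cdot> k'" "f \<in> Mor A \<Longrightarrow> \<tau> f \<rhd> k = \<tau> f \<rhd> k'"
    by (simp_all add: precone_def)
qed

text \<open>Merging reduces each kind of condition to one equation, so that the joint equifier of a
  finite set, obtained by induction, is enough.\<close>

lemma ex_sigma_equations:
  assumes size: "Mor A \<lesssim> U" "Cell A \<lesssim> U" and S: "S \<subseteq> Mor A"
    and S_l: "\<And>f. f \<in> S \<Longrightarrow> Fun1 F f \<cdot> l (Dom A f) = l (Cod A f)"
  shows "\<exists>C. finite C \<and> (\<forall>c\<in>C. equation N c) \<and>
    (\<forall>k\<in>Mor B. Cod B k = N \<longrightarrow> (\<forall>c\<in>C. solves k c) \<longleftrightarrow> solves_sigma S k)"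
proof -
  have small: "T \<lesssim> U" if "T \<subseteq> Mor A" for T
    using subset_imp_lepoll[OF that] size(1) by (rule lepoll_trans)
  have "equation N (id_eq f)" if "f \<in> S" for f
    using that S S_l by (intro equation_id_eq) auto
  then obtain c where c: "equation N c"
    "\<forall>k\<in>Mor B. Cod B k = N \<longrightarrow> solves k c \<longleftrightarrow> (\<forall>f\<in>S. solves k (id_eq f))"
    using ex_merged_equation[OF small[OF S] con_N, of id_eq] by blast
  \<comment> \<open>The composable pairs need not embed into \<open>U\<close>, so their equations are merged in two stages.\<close>
  have "\<forall>f\<in>Mor A. \<exists>d. equation N d \<and> (\<forall>k\<in>Mor B. Cod B k = N \<longrightarrow>
      solves k d \<longleftrightarrow> (\<forall>g\<in>{g \<in> Mor A. Dom A g = Cod A f}. solves k (comp_eq f g)))"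
    by (intro ballI ex_merged_equation small con_N) (auto intro: equation_comp_eq)
  from bchoice[OF this] obtain d' where d': "\<forall>f\<in>Mor A. equation N (d' f) \<and>
    (\<forall>k\<in>Mor B. Cod B k = N \<longrightarrow>
      solves k (d' f) \<longleftrightarrow> (\<forall>g\<in>{g \<in> Mor A. Dom A g = Cod A f}. solves k (comp_eq f g)))" ..
  then have "equation N (d' f)" if "f \<in> Mor A" for f using that by blast
  then obtain d where d: "equation N d"
    "\<forall>k\<in>Mor B. Cod B k = N \<longrightarrow> solves k d \<longleftrightarrow> (\<forall>f\<in>Mor A. solves k (d' f))"
    using ex_merged_equation[OF size(1) con_N, of d'] by blast
  obtain e where e: "equation N e"
    "\<forall>k\<in>Mor B. Cod B k = N \<longrightarrow> solves k e \<longleftrightarrow> (\<forall>\<gamma>\<in>Cell A. solves k (nat_eq \<gamma>))"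
    using ex_merged_equation[OF size(2) con_N, of nat_eq] equation_nat_eq by blast
  have "(\<forall>c\<in>{c, d, e}. solves k c) \<longleftrightarrow> solves_sigma S k" if "k \<in> Mor B" "Cod B k = N" for k
    using that c(2) d(2) d' e(2) by (simp add: solves_sigma_def)
  then show ?thesis using c(1) d(1) e(1) by (intro exI[of _ "{c, d, e}"]) auto
qed

text \<open>The limit cone is \<open>precone e\<close> for a joint equifier \<open>e\<close> of the
  cone equations. Its universal property is that of \<open>N\<close> restricted along
  \<open>e\<close>: an arrow into \<open>N\<close> lifts along \<open>e\<close> exactly when its
  precone is a \<sigma>-s-cone.\<close>

lemma ex_sigma_s_limit:
  assumes size: "Mor A \<lesssim> U" "Cell A \<lesssim> U"
    and S: "S \<subseteq> Mor A" "\<And>X. X \<in> Ob A \<Longrightarrow> Ide A X \<in> S"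
    and z: "\<And>X. X \<in> Ob A \<Longrightarrow> z X \<in> Ob A"
    and t: "\<And>X. X \<in> Ob A \<Longrightarrow> t X \<in> S \<and> Dom A (t X) = z X \<and> Cod A (t X) = X"
    and zt: "\<And>f. f \<in> S \<Longrightarrow> z (Dom A f) = z (Cod A f) \<and> f \<cdot>\<^bsub>A\<^esub> t (Dom A f) = t (Cod A f)"
  shows "\<exists>L \<pi>. is_sigma_s_limit A S B F L \<pi> \<and> con_ob L \<and>
    (\<forall>X\<in>Ob A. con_arr (leg \<pi> X)) \<and> (\<forall>f\<in>Mor A. con_cell (tri \<pi> f))"
proof -
  have tM: "t X \<in> Mor A" "Dom A (t X) = z X" "Cod A (t X) = X" "t X \<in> S" if "X \<in> Ob A" for X
    using t[OF that] S by auto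
  \<comment> \<open>Both sides are the leg at the common initial object followed by the image of
    \<open>t (Cod A f)\<close>.\<close>
  have S_l: "Fun1 F f \<cdot> l (Dom A f) = l (Cod A f)" if "f \<in> S" for f
  proof -
    have f: "f \<in> Mor A" using that S by auto
    then have D: "Dom A f \<in> Ob A" "Cod A f \<in> Ob A" by simp_all
    have "Fun1 F f \<cdot> l (Dom A f) = Fun1 F f \<cdot> (Fun1 F (t (Dom A f)) \<cdot> l (z (Dom A f)))"
      using l_t[OF D(1)] by simp
    also have "\<dots> = Fun1 F (f \<cdot>\<^bsub>A\<^esub> t (Dom A f)) \<cdot> l (z (Dom A f))"
      using f D(1) tM[OF D(1)] z[OF D(1)] by (simp add: Fun1_Comp Comp_assoc)
    also have "\<dots> = l (Cod A f)" using zt[OF that] l_t[OF D(2)] by simp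
    finally show ?thesis .
  qed
  obtain C where C: "finite C" "\<forall>c\<in>C. equation N c"
    "\<forall>k\<in>Mor B. Cod B k = N \<longrightarrow> (\<forall>c\<in>C. solves k c) \<longleftrightarrow> solves_sigma S k"
    using ex_sigma_equations[OF size S(1) S_l] by blast
  obtain e where e: "joint_equifier N C e" by (rule ex_joint_equifier[OF C(1) con_N]) (use C(2) in auto)
  note eD = joint_equifierD[OF e]
  define L where "L = Dom B e"
  have eL: "e \<in> Mor B" "Dom B e = L" "Cod B e = N" "con_ob L" "L \<in> Ob B"
    using con_arrD[OF eD(1)] eD(2) by (simp_all add: L_def)
  have cone_iff: "precone k \<in> Ob (sigma_s_cone_cat A S B F (Dom B k)) \<longleftrightarrow> (\<forall>c\<in>C. solves k c)"
    if "k \<in> Mor B" "Cod B k = N" for k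
    using precone_sigma_iff[OF S that] C(3) that by simp
  have \<pi>: "precone e \<in> Ob (sigma_s_cone_cat A S B F L)"
    using cone_iff[OF eL(1,3)] eD(3) eL(2) by simp
  \<comment> \<open>Composing the limit cone with \<open>h\<close> amounts to evaluating the generic
    precone at \<open>e \<cdot> h\<close>, which moves all questions about the limit to
    \<open>N\<close>.\<close>
  have pre: "cone_precomp A B (precone e) h = precone (e \<cdot> h)" if "h \<in> Mor B" "Cod B h = L" for h
    using that eL by (auto simp: cone_precomp_def precone_def Comp_assoc rwhisk_Comp intro!: restrict_ext)
  have pre2: "lwhisk B (leg (precone e) X) \<alpha> = l X \<lhd> (e \<lhd> \<alpha>)"
    if "X \<in> Ob A" "\<alpha> \<in> Cell B" "Cod B (Dom2 B \<alpha>) = L" for X \<alpha>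
    using that eL by (simp add: precone_def lwhisk_Comp)
  have arr_inj: "h = h'" if h: "h \<in> Mor B" "h' \<in> Mor B" "Dom B h = Dom B h'" "Cod B h = L" "Cod B h' = L"
      and eq: "precone (e \<cdot> h) = precone (e \<cdot> h')" for h h'
  proof -
    have "e \<cdot> h = e \<cdot> h'"
      by (rule arr_unique[OF _ _ _ _ _ precone_eqD[OF eq]]) (use h eL in simp_all)
    then show ?thesis using h eL by (intro eD(5)[of h h']) simp_all
  qed
  have arr_ex: "\<exists>h\<in>Mor B. Dom B h = E \<and> Cod B h = L \<and> precone (e \<cdot> h) = \<theta>"
    if E: "E \<in> Ob B" and \<theta>: "\<theta> \<in> Ob (sigma_s_cone_cat A S B F E)" for E \<theta>
  proof -
    have lax: "lax_cone A B F E \<theta>" using \<theta> by (simp add: sigma_cone_simps)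
    note \<theta>D = lax_coneD[OF lax]
    have "\<exists>k\<in>Mor B. Dom B k = E \<and> Cod B k = N \<and> (\<forall>X\<in>Ob A. l X \<cdot> k = leg \<theta> X) \<and>
        (\<forall>f\<in>Mor A. \<tau> f \<rhd> k = tri \<theta> f)"
    proof (rule precone_arr[OF E])
      show "leg \<theta> X = Fun1 F (t X) \<cdot> leg \<theta> (z X)" if "X \<in> Ob A" for X
        using sigma_cone_tri(2)[OF \<theta>, of "t X"] tM[OF that] by simp
    qed (use \<theta>D(1-6) in auto)
    then obtain k where k: "k \<in> Mor B" "Dom B k = E" "Cod B k = N" "\<And>X. X \<in> Ob A \<Longrightarrow> l X \<cdot> k = leg \<theta> X"
      "\<And>f. f \<in> Mor A \<Longrightarrow> \<tau> f \<rhd> k = tri \<theta> f" by blast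
    have "leg (precone k) = leg \<theta>"
      by (rule extensionalityI[OF _ \<theta>D(10)]) (simp_all add: precone_def k(4))
    moreover have "tri (precone k) = tri \<theta>"
      by (rule extensionalityI[OF _ \<theta>D(11)]) (simp_all add: precone_def k(5))
    ultimately have k\<theta>: "precone k = \<theta>" by simp
    \<comment> \<open>The criterion is read backwards: since \<open>precone k\<close> is the given
      cone \<open>\<theta>\<close>, the arrow \<open>k\<close> must solve all equations and
      therefore lifts along \<open>e\<close>.\<close>
    then have "\<And>c. c \<in> C \<Longrightarrow> solves k c" using cone_iff[OF k(1,3)] \<theta> k(2) by simp
    from eD(4)[OF k(1,3) this] k\<theta> k(2) show ?thesis by (auto simp: L_def)
  qed
  have "is_sigma_s_limit A S B F L (precone e)"
    unfolding is_sigma_s_limit_def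
  proof (intro conjI ballI)
    fix E assume E: "E \<in> Ob B"
    let ?D = "sigma_s_cone_cat A S B F E"
    note func = sigma_cone_precomp_functor[OF \<pi> S(1), of E]
    show "iso_functor (hom_cat B E L) ?D (cone_precomp A B (precone e)) (cone_precomp2 A B (precone e))"
    proof (rule iso_functorI[OF category_hom_cat func])
      show "bij_betw (cone_precomp A B (precone e)) (Ob (hom_cat B E L)) (Ob ?D)"
      proof (rule bij_betw_imageI)
        show "inj_on (cone_precomp A B (precone e)) (Ob (hom_cat B E L))"
        proof (rule inj_onI)
          fix h h' assume "h \<in> Ob (hom_cat B E L)" "h' \<in> Ob (hom_cat B E L)"
            "cone_precomp A B (precone e) h = cone_precomp A B (precone e) h'"
          then show "h = h'" by - (rule arr_inj, simp_all add: hom_cat_simps pre)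
        qed
        have "\<theta> \<in> cone_precomp A B (precone e) ` Ob (hom_cat B E L)" if "\<theta> \<in> Ob ?D" for \<theta>
        proof -
          from arr_ex[OF E that] obtain h where "h \<in> Mor B" "Dom B h = E" "Cod B h = L"
            "precone (e \<cdot> h) = \<theta>" by blast
          then show ?thesis by (intro image_eqI[of _ _ h]) (simp_all add: pre hom_cat_simps)
        qed
        then show "cone_precomp A B (precone e) ` Ob (hom_cat B E L) = Ob ?D"
          using func by (auto simp: is_functor_def)
      qed
      show "bij_betw (cone_precomp2 A B (precone e)) (Mor (hom_cat B E L)) (Mor ?D)"
      proof (rule bij_betw_imageI)
        show "inj_on (cone_precomp2 A B (precone e)) (Mor (hom_cat B E L))"
        proof (rule inj_onI)
          fix \<alpha> \<beta> assume "\<alpha> \<in> Mor (hom_cat B E L)" "\<beta> \<in> Mor (hom_cat B E L)"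
            and eq: "cone_precomp2 A B (precone e) \<alpha> = cone_precomp2 A B (precone e) \<beta>"
          then have ab: "\<alpha> \<in> Cell B" "Dom B (Dom2 B \<alpha>) = E" "Cod B (Dom2 B \<alpha>) = L"
            "\<beta> \<in> Cell B" "Dom B (Dom2 B \<beta>) = E" "Cod B (Dom2 B \<beta>) = L"
            by (simp_all add: hom_cat_simps)
          have eqs: "precone (e \<cdot> Dom2 B \<alpha>) = precone (e \<cdot> Dom2 B \<beta>)"
            "precone (e \<cdot> Cod2 B \<alpha>) = precone (e \<cdot> Cod2 B \<beta>)"
            and fam: "(\<lambda>X\<in>Ob A. leg (precone e) X \<lhd> \<alpha>) = (\<lambda>X\<in>Ob A. leg (precone e) X \<lhd> \<beta>)"
            using eq ab by (simp_all add: cone_precomp2_def pre)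
          have l_eq: "l X \<lhd> (e \<lhd> \<alpha>) = l X \<lhd> (e \<lhd> \<beta>)" if "X \<in> Ob A" for X
            using fun_cong[OF fam, of X] that ab by (simp add: pre2)
          \<comment> \<open>\<open>cell_unique\<close> asks for equal codomains as well as equal
            domains, a trace of the inserter. Both follow from the injectivity on arrows, because a
            cone morphism carries its two cones.\<close>
          have dom: "Dom2 B \<alpha> = Dom2 B \<beta>" by (rule arr_inj[OF _ _ _ _ _ eqs(1)]) (use ab in simp_all)
          have cod: "Cod2 B \<alpha> = Cod2 B \<beta>" by (rule arr_inj[OF _ _ _ _ _ eqs(2)]) (use ab in simp_all)
          have "e \<lhd> \<alpha> = e \<lhd> \<beta>"
            by (rule cell_unique[OF _ _ _ _ _ l_eq]) (use ab eL dom cod in simp_all)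
          then show "\<alpha> = \<beta>" using ab dom eL by (intro eD(7)[of \<alpha> \<beta>]) simp_all
        qed
        have "m \<in> cone_precomp2 A B (precone e) ` Mor (hom_cat B E L)" if m: "m \<in> Mor ?D" for m
        proof -
          obtain \<theta> a \<theta>' where m_eq: "m = (\<theta>, a, \<theta>')" by (cases m)
          have mor: "\<theta> \<in> Ob ?D" "\<theta>' \<in> Ob ?D"
            "a \<in> (\<Pi>\<^sub>E X\<in>Ob A. {\<mu> \<in> Cell B. Dom2 B \<mu> = leg \<theta> X \<and> Cod2 B \<mu> = leg \<theta>' X})"
            "\<And>f. f \<in> Mor A \<Longrightarrow> tri \<theta>' f \<bullet> (Fun1 F f \<lhd> a (Dom A f)) = a (Cod A f) \<bullet> tri \<theta> f"
            using m by (simp_all add: m_eq sigma_cone_simps(2))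
          obtain h where h: "h \<in> Mor B" "Dom B h = E" "Cod B h = L" "precone (e \<cdot> h) = \<theta>"
            using arr_ex[OF E mor(1)] by blast
          obtain h' where h': "h' \<in> Mor B" "Dom B h' = E" "Cod B h' = L" "precone (e \<cdot> h') = \<theta>'"
            using arr_ex[OF E mor(2)] by blast
          have legs: "leg \<theta> X = l X \<cdot> (e \<cdot> h)" "leg \<theta>' X = l X \<cdot> (e \<cdot> h')" if "X \<in> Ob A" for X
            using that h(4) h'(4) by (auto simp: precone_def)
          have tris: "tri \<theta> f = \<tau> f \<rhd> (e \<cdot> h)" "tri \<theta>' f = \<tau> f \<rhd> (e \<cdot> h')" if "f \<in> Mor A" for f
            using that h(4) h'(4) by (auto simp: precone_def)
          have a: "a X \<in> Cell B" "Dom2 B (a X) = leg \<theta> X" "Cod2 B (a X) = leg \<theta>' X" if "X \<in> Ob A" for X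
            using mor(3) that by (auto simp: PiE_iff)
          \<comment> \<open>At \<open>t X\<close> the triangles of both cones are identities, so the
            naturality square of \<open>a\<close> collapses to this equation.\<close>
          have a_t: "a X = Fun1 F (t X) \<lhd> a (z X)" if X: "X \<in> Ob A" for X
          proof -
            note tX = tM[OF X]
            have "Ide2 B (leg \<theta>' X) \<bullet> (Fun1 F (t X) \<lhd> a (z X)) = a X \<bullet> Ide2 B (leg \<theta> X)"
              using mor(4)[OF tX(1)] sigma_cone_tri(1)[OF mor(1) tX(4,1)]
                sigma_cone_tri(1)[OF mor(2) tX(4,1)] tX by simp
            moreover have "Fun1 F (t X) \<cdot> leg \<theta>' (z X) = leg \<theta>' X"
              using sigma_cone_tri(2)[OF mor(2) tX(4,1)] tX by simp
            ultimately show ?thesis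
              using a[OF X] a[OF z[OF X]] tX legs(1)[OF z[OF X]] z[OF X] h eL by simp
          qed
          \<comment> \<open>With \<open>a_t\<close> and the naturality squares, the family lifts to
            a 2-cell between arrows into \<open>N\<close>. Fullness of \<open>e\<close> then lifts
            it to the limit without a further condition.\<close>
          have "\<exists>\<gamma>\<in>Cell B. Dom2 B \<gamma> = e \<cdot> h \<and> Cod2 B \<gamma> = e \<cdot> h' \<and> (\<forall>X\<in>Ob A. l X \<lhd> \<gamma> = a X)"
            by (rule precone_cell[OF _ _ _ _ _ _ a_t]) (use h h' eL a legs tris mor(4) in auto)
          then obtain \<gamma> where \<gamma>: "\<gamma> \<in> Cell B" "Dom2 B \<gamma> = e \<cdot> h" "Cod2 B \<gamma> = e \<cdot> h'"
            "\<And>X. X \<in> Ob A \<Longrightarrow> l X \<lhd> \<gamma> = a X" by blast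
          have "\<exists>\<alpha>\<in>Cell B. Dom2 B \<alpha> = h \<and> Cod2 B \<alpha> = h' \<and> e \<lhd> \<alpha> = \<gamma>"
            by (rule eD(6)) (use h h' eL \<gamma> in simp_all)
          then obtain \<alpha> where \<alpha>: "\<alpha> \<in> Cell B" "Dom2 B \<alpha> = h" "Cod2 B \<alpha> = h'" "e \<lhd> \<alpha> = \<gamma>" by blast
          have "(\<lambda>X\<in>Ob A. leg (precone e) X \<lhd> \<alpha>) = a"
          proof (rule extensionalityI)
            show "a \<in> extensional (Ob A)" using mor(3) by (simp add: PiE_iff)
          qed (use \<alpha> \<gamma>(4) h in \<open>simp_all add: pre2\<close>)
          then have "cone_precomp2 A B (precone e) \<alpha> = m"
            using \<alpha> h h' by (simp add: cone_precomp2_def pre m_eq)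
          then show ?thesis using \<alpha> h by (intro image_eqI[of _ _ \<alpha>]) (simp_all add: hom_cat_simps)
        qed
        then show "cone_precomp2 A B (precone e) ` Mor (hom_cat B E L) = Mor ?D"
          using func by (auto simp: is_functor_def)
      qed
    qed
  qed (use \<pi> eL in simp_all)
  moreover have "con_arr (leg (precone e) X)" if "X \<in> Ob A" for X
    using that eD(1) eL by (simp add: precone_def PIE_ob_PIE_arr_PIE_cell.comp)
  moreover have "con_cell (tri (precone e) f)" if "f \<in> Mor A" for f
    using that eD(1) eL by (simp add: precone_def con_rwhisk)
  ultimately show ?thesis using eL(4) by blast
qed

end

theorem proposition2p15:
  fixes U :: "'i set"
    and A :: "('oa, 'aa, 'ca) twocat"
    and S :: "'aa set"
    and B :: "('ob, 'ab, 'cb) twocat"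
    and F :: "('oa, 'aa, 'ca, 'ob, 'ab, 'cb) twofun"
    and K :: "('i, 'ob, 'ab, 'cb) PIE_ops"
  assumes "PIE_indexing_pair U A S"
    and "two_category B"
    and "two_functor A B F"
    and "PIE_choice U B K"
  shows "\<exists>L \<pi>. is_sigma_s_limit A S B F L \<pi> \<and>
    PIE_ob U B K A F L \<and>
    (\<forall>X\<in>Ob A. PIE_arr U B K A F (leg \<pi> X)) \<and>
    (\<forall>f\<in>Mor A. PIE_cell U B K A F (tri \<pi> f))"
proof -
  from assms(1) have pair: "two_category A" "Ob A \<lesssim> U" "Mor A \<lesssim> U" "Cell A \<lesssim> U" "S \<subseteq> Mor A"
    "\<And>X. X \<in> Ob A \<Longrightarrow> Ide A X \<in> S"
    by (auto simp: PIE_indexing_pair_def indexing_pair_def small_two_category_def)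
  interpret B: two_category B by (rule assms(2))
  interpret A: two_category A by (rule pair(1))
  interpret pie_setting B A F U K by unfold_locales (use assms in auto)
  obtain z t where zt:
    "\<And>X. X \<in> Ob A \<Longrightarrow> z X \<in> Ob A"
    "\<And>X. X \<in> Ob A \<Longrightarrow> t X \<in> S \<and> Dom A (t X) = z X \<and> Cod A (t X) = X"
    "\<And>f. f \<in> S \<Longrightarrow> z (Dom A f) = z (Cod A f) \<and> f \<cdot>\<^bsub>A\<^esub> t (Dom A f) = t (Cod A f)"
    "\<And>X. X \<in> Ob A \<Longrightarrow> t (z X) = Ide A (z X)"
    by (rule PIE_initial[OF assms(1)]) blast
  obtain N l \<tau> where "generic_precone B A F U K z t N l \<tau>"
    by (rule ex_generic_precone[OF pair(2,3,5) zt])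
  then interpret generic_precone B A F U K z t N l \<tau> .
  show ?thesis by (rule ex_sigma_s_limit[OF pair(3-6) zt(1-3)])
qed

end
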